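(* Let $A$ be an associative ring with unit and let $X$ be a $\mathbb{Z}$-graded complex of left $A$-modules with differential $d$ of degree $-1$. Let $Y=\mathrm{End}_A(X)$ be the graded associative algebra of $A$-endomorphisms of $X$ with its differential $\mathbf{d}$ of degree $+1$. Then the homology space $H^*(Y)$ of $(Y,\mathbf{d})$ inherits a multiplicative structure from $Y$ (the product of the classes of two cocycles is the well-defined class of their composition), so that $H^*(Y)$ is a graded associative algebra.
   Context: Let $X=\{X^p\}_{p\in\mathbb{Z}}$ be a complex of left $A$-modules with differential $d:X^p\to X^{p-1}$, $d^2=0$. The graded algebra $Y=\mathrm{End}_A(X)$ is $Y=\bigoplus_{n\in\mathbb{Z}}Y^n$ with $Y^n=\prod_{p+q=n}Y^{p,q}$ and $Y^{p,q}=\mathrm{Hom}_A(X^p,X^{-q})$. Thus an element of degree $n$ is a family of $A$-linear maps $X^p\to X^{p-n}$, $p\in\mathbb{Z}$. The product $fg$ is the composition $f\circ g$. The differential $\mathbf{d}$ is defined on homogeneous $f$ by $\mathbf{d}f=d\circ f-(-1)^{\deg(f)}f\circ d$; it satisfies $\mathbf{d}^2=0$, and $H^n(Y)=\ker(\mathbf{d}|_{Y^n})/\mathbf{d}(Y^{n-1})$. *)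

theory Defs
  imports "HOL-Algebra.Algebra"
begin

text \<open>
  The library's locale \<^locale>\<open>module\<close> requires a commutative base ring; the following is the
  same list of axioms over an arbitrary associative ring with unit.
\<close>

locale left_module = R?: ring R + M?: abelian_group M
  for R :: "('a, 'k) ring_scheme" (structure) and M :: "('a, 'b, 'm) module_scheme" (structure) +
  assumes smult_closed:
      "\<lbrakk>a \<in> carrier R; x \<in> carrier M\<rbrakk> \<Longrightarrow> a \<odot>\<^bsub>M\<^esub> x \<in> carrier M"
    and smult_l_distr:
      "\<lbrakk>a \<in> carrier R; b \<in> carrier R; x \<in> carrier M\<rbrakk> \<Longrightarrow>
        (a \<oplus> b) \<odot>\<^bsub>M\<^esub> x = a \<odot>\<^bsub>M\<^esub> x \<oplus>\<^bsub>M\<^esub> b \<odot>\<^bsub>M\<^esub> x"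
    and smult_r_distr:
      "\<lbrakk>a \<in> carrier R; x \<in> carrier M; y \<in> carrier M\<rbrakk> \<Longrightarrow>
        a \<odot>\<^bsub>M\<^esub> (x \<oplus>\<^bsub>M\<^esub> y) = a \<odot>\<^bsub>M\<^esub> x \<oplus>\<^bsub>M\<^esub> a \<odot>\<^bsub>M\<^esub> y"
    and smult_assoc:
      "\<lbrakk>a \<in> carrier R; b \<in> carrier R; x \<in> carrier M\<rbrakk> \<Longrightarrow>
        (a \<otimes> b) \<odot>\<^bsub>M\<^esub> x = a \<odot>\<^bsub>M\<^esub> (b \<odot>\<^bsub>M\<^esub> x)"
    and smult_one:
      "x \<in> carrier M \<Longrightarrow> \<one> \<odot>\<^bsub>M\<^esub> x = x"

text \<open>
  Linear maps are represented extensionally (value \<^const>\<open>undefined\<close> outside the source), so that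
  equality of representing functions is equality of maps.
\<close>

definition lin_maps ::
    "('a, 'k) ring_scheme \<Rightarrow> ('a, 'b, 'm) module_scheme \<Rightarrow> ('a, 'b, 'm) module_scheme \<Rightarrow> ('b \<Rightarrow> 'b) set"
  where "lin_maps A M N =
    {f \<in> carrier M \<rightarrow>\<^sub>E carrier N.
       (\<forall>x\<in>carrier M. \<forall>y\<in>carrier M. f (x \<oplus>\<^bsub>M\<^esub> y) = f x \<oplus>\<^bsub>N\<^esub> f y) \<and>
       (\<forall>a\<in>carrier A. \<forall>x\<in>carrier M. f (a \<odot>\<^bsub>M\<^esub> x) = a \<odot>\<^bsub>N\<^esub> f x)}"

locale chain_complex =
  fixes A :: "('a, 'k) ring_scheme" and C :: "int \<Rightarrow> ('a, 'b, 'm) module_scheme" and d :: "int \<Rightarrow> 'b \<Rightarrow> 'b"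
  assumes base_ring: "ring A"
    and left_module: "left_module A (C p)"
    and d_linear: "d p \<in> lin_maps A (C p) (C (p - 1))"
    and d_squared: "x \<in> carrier (C p) \<Longrightarrow> d (p - 1) (d p x) = \<zero>\<^bsub>C (p - 1 - 1)\<^esub>"

text \<open>
  Additive groups are represented, as for \<^const>\<open>product_group\<close>, \<^const>\<open>sum_group\<close> and
  \<^const>\<open>FactGroup\<close>, by \<^typ>\<open>'a monoid\<close> records whose \<^const>\<open>monoid.mult\<close> is the addition
  and whose \<^const>\<open>monoid.one\<close> is zero.
\<close>

definition Hom_group ::
    "('a, 'k) ring_scheme \<Rightarrow> ('a, 'b, 'm) module_scheme \<Rightarrow> ('a, 'b, 'm) module_scheme \<Rightarrow> ('b \<Rightarrow> 'b) monoid"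
  where "Hom_group A M N =
    \<lparr>carrier = lin_maps A M N,
     monoid.mult = (\<lambda>f g. \<lambda>x\<in>carrier M. f x \<oplus>\<^bsub>N\<^esub> g x),
     one = (\<lambda>x\<in>carrier M. \<zero>\<^bsub>N\<^esub>)\<rparr>"

definition End_deg ::
    "('a, 'k) ring_scheme \<Rightarrow> (int \<Rightarrow> ('a, 'b, 'm) module_scheme) \<Rightarrow> int \<Rightarrow> (int \<Rightarrow> 'b \<Rightarrow> 'b) monoid"
  where "End_deg A C n = product_group UNIV (\<lambda>p. Hom_group A (C p) (C (p - n)))"

text \<open>Composition \<open>f \<circ> g\<close>, where \<open>n\<close> is the degree of \<open>g\<close> (the degree of \<open>f\<close> is not needed).\<close>

definition end_comp ::
    "(int \<Rightarrow> ('a, 'b, 'm) module_scheme) \<Rightarrow> int \<Rightarrow> (int \<Rightarrow> 'b \<Rightarrow> 'b) \<Rightarrow> (int \<Rightarrow> 'b \<Rightarrow> 'b) \<Rightarrow> (int \<Rightarrow> 'b \<Rightarrow> 'b)"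
  where "end_comp C n f g = (\<lambda>p. compose (carrier (C p)) (f (p - n)) (g p))"

definition end_id :: "(int \<Rightarrow> ('a, 'b, 'm) module_scheme) \<Rightarrow> int \<Rightarrow> 'b \<Rightarrow> 'b"
  where "end_id C = (\<lambda>p. \<lambda>x\<in>carrier (C p). x)"

text \<open>\<open>d \<circ> f - (-1)\<^sup>n f \<circ> d\<close> for \<open>f\<close> of degree \<open>n\<close>.\<close>

definition end_diff ::
    "(int \<Rightarrow> ('a, 'b, 'm) module_scheme) \<Rightarrow> (int \<Rightarrow> 'b \<Rightarrow> 'b) \<Rightarrow> int \<Rightarrow> (int \<Rightarrow> 'b \<Rightarrow> 'b) \<Rightarrow> (int \<Rightarrow> 'b \<Rightarrow> 'b)"
  where "end_diff C d n f = (\<lambda>p. \<lambda>x\<in>carrier (C p).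
    d (p - n) (f p x) \<ominus>\<^bsub>C (p - n - 1)\<^esub>
      (if even n then f (p - 1) (d p x) else \<ominus>\<^bsub>C (p - n - 1)\<^esub> f (p - 1) (d p x)))"

definition cocycles ::
    "('a, 'k) ring_scheme \<Rightarrow> (int \<Rightarrow> ('a, 'b, 'm) module_scheme) \<Rightarrow> (int \<Rightarrow> 'b \<Rightarrow> 'b) \<Rightarrow> int
      \<Rightarrow> (int \<Rightarrow> 'b \<Rightarrow> 'b) set"
  where "cocycles A C d n = kernel (End_deg A C n) (End_deg A C (n + 1)) (end_diff C d n)"

definition coboundaries ::
    "('a, 'k) ring_scheme \<Rightarrow> (int \<Rightarrow> ('a, 'b, 'm) module_scheme) \<Rightarrow> (int \<Rightarrow> 'b \<Rightarrow> 'b) \<Rightarrow> int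
      \<Rightarrow> (int \<Rightarrow> 'b \<Rightarrow> 'b) set"
  where "coboundaries A C d n = end_diff C d (n - 1) ` carrier (End_deg A C (n - 1))"

definition cohomology ::
    "('a, 'k) ring_scheme \<Rightarrow> (int \<Rightarrow> ('a, 'b, 'm) module_scheme) \<Rightarrow> (int \<Rightarrow> 'b \<Rightarrow> 'b) \<Rightarrow> int
      \<Rightarrow> (int \<Rightarrow> 'b \<Rightarrow> 'b) set monoid"
  where "cohomology A C d n =
    (End_deg A C n)\<lparr>carrier := cocycles A C d n\<rparr> Mod coboundaries A C d n"

definition coh_class ::
    "('a, 'k) ring_scheme \<Rightarrow> (int \<Rightarrow> ('a, 'b, 'm) module_scheme) \<Rightarrow> (int \<Rightarrow> 'b \<Rightarrow> 'b) \<Rightarrow> int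
      \<Rightarrow> (int \<Rightarrow> 'b \<Rightarrow> 'b) \<Rightarrow> (int \<Rightarrow> 'b \<Rightarrow> 'b) set"
  where "coh_class A C d n f = coboundaries A C d n #>\<^bsub>End_deg A C n\<^esub> f"

text \<open>
  As in \<^const>\<open>rcoset_mult\<close>, the product of two classes is the union of the classes of all
  products of representatives; it is a single class exactly if the product is well defined.
\<close>

definition coh_mult ::
    "('a, 'k) ring_scheme \<Rightarrow> (int \<Rightarrow> ('a, 'b, 'm) module_scheme) \<Rightarrow> (int \<Rightarrow> 'b \<Rightarrow> 'b) \<Rightarrow> int \<Rightarrow> int
      \<Rightarrow> (int \<Rightarrow> 'b \<Rightarrow> 'b) set \<Rightarrow> (int \<Rightarrow> 'b \<Rightarrow> 'b) set \<Rightarrow> (int \<Rightarrow> 'b \<Rightarrow> 'b) set"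
  where "coh_mult A C d m n U V =
    (\<Union>f\<in>U. \<Union>g\<in>V. coh_class A C d (m + n) (end_comp C n f g))"

definition homogeneous :: "(int \<Rightarrow> ('c, 'm) monoid_scheme) \<Rightarrow> int \<Rightarrow> 'c \<Rightarrow> int \<Rightarrow> 'c"
  where "homogeneous G n a = (\<lambda>k. if k = n then a else \<one>\<^bsub>G k\<^esub>)"

text \<open>
  The direct sum of additive groups \<open>G n\<close>, with multiplication extended biadditively from
  \<open>mul i j : G i \<times> G j \<rightarrow> G (i + j)\<close> and with unit \<open>e\<close> in degree \<open>0\<close>. The \<^const>\<open>finprod\<close> below
  is a finite sum in the additive group \<open>G n\<close>.
\<close>

definition graded_sum ::
    "(int \<Rightarrow> ('c, 'm) monoid_scheme) \<Rightarrow> (int \<Rightarrow> int \<Rightarrow> 'c \<Rightarrow> 'c \<Rightarrow> 'c) \<Rightarrow> 'c \<Rightarrow> (int \<Rightarrow> 'c) ring"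
  where "graded_sum G mul e =
    \<lparr>carrier = carrier (sum_group UNIV G),
     monoid.mult = (\<lambda>x y n. finprod (G n) (\<lambda>i. mul i (n - i) (x i) (y (n - i)))
                       {i. x i \<noteq> \<one>\<^bsub>G i\<^esub> \<and> y (n - i) \<noteq> \<one>\<^bsub>G (n - i)\<^esub>}),
     one = homogeneous G 0 e,
     ring.zero = \<one>\<^bsub>sum_group UNIV G\<^esub>,
     ring.add = monoid.mult (sum_group UNIV G)\<rparr>"

locale graded_ring = ring R for R (structure) +
  fixes Gr :: "int \<Rightarrow> 'a set"
  assumes component: "additive_subgroup (Gr n) R"
    and one_deg: "\<one> \<in> Gr 0"
    and mult_deg: "\<lbrakk>x \<in> Gr m; y \<in> Gr n\<rbrakk> \<Longrightarrow> x \<otimes> y \<in> Gr (m + n)"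
    and direct_sum: "x \<in> carrier R \<Longrightarrow>
      \<exists>!c. (\<forall>n. c n \<in> Gr n) \<and> finite {n. c n \<noteq> \<zero>} \<and> x = (\<Oplus>n\<in>{n. c n \<noteq> \<zero>}. c n)"

definition End_algebra ::
    "('a, 'k) ring_scheme \<Rightarrow> (int \<Rightarrow> ('a, 'b, 'm) module_scheme) \<Rightarrow> (int \<Rightarrow> int \<Rightarrow> 'b \<Rightarrow> 'b) ring"
  where "End_algebra A C = graded_sum (End_deg A C) (\<lambda>m n. end_comp C n) (end_id C)"

definition End_differential ::
    "(int \<Rightarrow> ('a, 'b, 'm) module_scheme) \<Rightarrow> (int \<Rightarrow> 'b \<Rightarrow> 'b)
      \<Rightarrow> (int \<Rightarrow> int \<Rightarrow> 'b \<Rightarrow> 'b) \<Rightarrow> (int \<Rightarrow> int \<Rightarrow> 'b \<Rightarrow> 'b)"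
  where "End_differential C d y = (\<lambda>n. end_diff C d (n - 1) (y (n - 1)))"

definition cohomology_algebra ::
    "('a, 'k) ring_scheme \<Rightarrow> (int \<Rightarrow> ('a, 'b, 'm) module_scheme) \<Rightarrow> (int \<Rightarrow> 'b \<Rightarrow> 'b)
      \<Rightarrow> (int \<Rightarrow> (int \<Rightarrow> 'b \<Rightarrow> 'b) set) ring"
  where "cohomology_algebra A C d =
    graded_sum (cohomology A C d) (coh_mult A C d) (coh_class A C d 0 (end_id C))"

end

theory Submission
  imports Defs
begin

text \<open>
  The differential of the endomorphism algebra is a graded commutator. The differential \<open>d\<close> of the
  complex is itself an element of degree one of the endomorphism algebra, its square is zero, and
  \<open>\<^bold>d f = d f - (-1)\<^sup>n f d\<close> for \<open>f\<close> of degree \<open>n\<close>. In any graded ring, the commutator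
  with an element of degree one satisfies the signed Leibniz rule
  \<open>\<^bold>d (f g) = (\<^bold>d f) g + (-1)\<^sup>m f (\<^bold>d g)\<close> for \<open>f\<close> of degree \<open>m\<close> (lemma \<open>bracket_leibniz\<close>),
  and it squares to zero if the element does (lemma \<open>bracket_bracket\<close>). The Leibniz rule shows
  that a product of cocycles is a cocycle, and that a product of a cocycle and a coboundary, in
  either order, is a coboundary. So the cocycles form a graded subring in which the coboundaries
  are a graded two-sided ideal, and the cohomology is the quotient, with everything that this
  entails: well-defined products of classes, associativity, a unit, and a ring homomorphism from
  cocycles to classes.

  The argument therefore has three layers, of which only the last mentions modules. A family of
  additive groups with a biadditive, associative, unital product \<open>G i \<times> G j \<rightarrow> G (i + j)\<close> has a
  direct sum that is a graded ring (theorem \<open>graded_ring_total\<close>), and the quotient of a graded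
  subring by a graded ideal is again such a family (theorem \<open>graded_product_quotient\<close>). In such a
  family, an element of degree one with square zero yields a graded subring and an ideal in it
  (theorem \<open>graded_subquotient_bracket\<close>). Finally, the maps of degree \<open>n\<close> of a complex form such a
  family and the differential of the complex is such an element (lemma \<open>inner_differential_End\<close>).
\<close>


section \<open>Direct sums of additive groups with a graded product\<close>

text \<open>
  The axioms are those of a graded ring, stated on the homogeneous components, which are written
  multiplicatively although their operation is the addition. No component needs to be embedded in
  a common ring, so families of quotient groups fit as well as families of maps.
\<close>

locale graded_product =
  fixes G :: "int \<Rightarrow> ('c, 'm) monoid_scheme"
    and mul :: "int \<Rightarrow> int \<Rightarrow> 'c \<Rightarrow> 'c \<Rightarrow> 'c"
    and e :: 'c
  assumes component_comm_group: "comm_group (G n)"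
    and mul_closed:
      "\<lbrakk>x \<in> carrier (G i); y \<in> carrier (G j)\<rbrakk> \<Longrightarrow> mul i j x y \<in> carrier (G (i + j))"
    and mul_l_distr:
      "\<lbrakk>x \<in> carrier (G i); x' \<in> carrier (G i); y \<in> carrier (G j)\<rbrakk> \<Longrightarrow>
        mul i j (x \<otimes>\<^bsub>G i\<^esub> x') y = mul i j x y \<otimes>\<^bsub>G (i + j)\<^esub> mul i j x' y"
    and mul_r_distr:
      "\<lbrakk>x \<in> carrier (G i); y \<in> carrier (G j); y' \<in> carrier (G j)\<rbrakk> \<Longrightarrow>
        mul i j x (y \<otimes>\<^bsub>G j\<^esub> y') = mul i j x y \<otimes>\<^bsub>G (i + j)\<^esub> mul i j x y'"
    and mul_assoc:
      "\<lbrakk>x \<in> carrier (G i); y \<in> carrier (G j); z \<in> carrier (G k)\<rbrakk> \<Longrightarrow>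
        mul (i + j) k (mul i j x y) z = mul i (j + k) x (mul j k y z)"
    and unit_closed: "e \<in> carrier (G 0)"
    and unit_left: "x \<in> carrier (G n) \<Longrightarrow> mul 0 n e x = x"
    and unit_right: "x \<in> carrier (G n) \<Longrightarrow> mul n 0 x e = x"
begin

abbreviation total :: "(int \<Rightarrow> 'c) ring"
  where "total \<equiv> graded_sum G mul e"

interpretation G: comm_group "G n" for n
  by (rule component_comm_group)

lemma mul_one_left:
  assumes "y \<in> carrier (G j)"
  shows "mul i j \<one>\<^bsub>G i\<^esub> y = \<one>\<^bsub>G (i + j)\<^esub>"
proof -
  have "mul i j \<one>\<^bsub>G i\<^esub> y \<otimes>\<^bsub>G (i + j)\<^esub> mul i j \<one>\<^bsub>G i\<^esub> y = mul i j \<one>\<^bsub>G i\<^esub> y"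
    using mul_l_distr[of "\<one>\<^bsub>G i\<^esub>" i "\<one>\<^bsub>G i\<^esub>" y j] assms by simp
  then show ?thesis
    using mul_closed[of "\<one>\<^bsub>G i\<^esub>" i y j] assms by simp
qed

lemma mul_one_right:
  assumes "x \<in> carrier (G i)"
  shows "mul i j x \<one>\<^bsub>G j\<^esub> = \<one>\<^bsub>G (i + j)\<^esub>"
proof -
  have "mul i j x \<one>\<^bsub>G j\<^esub> \<otimes>\<^bsub>G (i + j)\<^esub> mul i j x \<one>\<^bsub>G j\<^esub> = mul i j x \<one>\<^bsub>G j\<^esub>"
    using mul_r_distr[of x i "\<one>\<^bsub>G j\<^esub>" j "\<one>\<^bsub>G j\<^esub>"] assms by simp
  then show ?thesis
    using mul_closed[of x i "\<one>\<^bsub>G j\<^esub>" j] assms by simp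
qed

lemma mul_closed_at:
  "\<lbrakk>x \<in> carrier (G i); y \<in> carrier (G (n - i))\<rbrakk> \<Longrightarrow> mul i (n - i) x y \<in> carrier (G n)"
  using mul_closed[of x i y "n - i"] by simp

lemma carrier_total:
  "x \<in> carrier total \<longleftrightarrow> (\<forall>n. x n \<in> carrier (G n)) \<and> finite {n. x n \<noteq> \<one>\<^bsub>G n\<^esub>}"
  by (simp add: graded_sum_def carrier_sum_group PiE_iff)

lemma add_total: "x \<oplus>\<^bsub>total\<^esub> y = (\<lambda>n. x n \<otimes>\<^bsub>G n\<^esub> y n)"
  by (simp add: graded_sum_def restrict_def)

lemma zero_total: "\<zero>\<^bsub>total\<^esub> = (\<lambda>n. \<one>\<^bsub>G n\<^esub>)"
  by (simp add: graded_sum_def restrict_def)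

lemma one_total: "\<one>\<^bsub>total\<^esub> = homogeneous G 0 e"
  by (simp add: graded_sum_def)

lemma component_closed: "x \<in> carrier total \<Longrightarrow> x n \<in> carrier (G n)"
  by (simp add: carrier_total)

lemma abelian_group_total: "abelian_group total"
proof (rule abelian_groupI)
  interpret SG: group "sum_group UNIV G"
    by simp
  have carr: "carrier total = carrier (sum_group UNIV G)"
    and add: "\<And>x y. x \<oplus>\<^bsub>total\<^esub> y = x \<otimes>\<^bsub>sum_group UNIV G\<^esub> y"
    and zero: "\<zero>\<^bsub>total\<^esub> = \<one>\<^bsub>sum_group UNIV G\<^esub>"
    by (simp_all add: graded_sum_def)
  show "\<zero>\<^bsub>total\<^esub> \<in> carrier total"
    unfolding carr zero by (rule SG.one_closed)
  fix x y z
  assume x: "x \<in> carrier total"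
  show "\<zero>\<^bsub>total\<^esub> \<oplus>\<^bsub>total\<^esub> x = x"
    using x unfolding carr zero add by (rule SG.l_one)
  show "\<exists>y\<in>carrier total. y \<oplus>\<^bsub>total\<^esub> x = \<zero>\<^bsub>total\<^esub>"
    using x unfolding carr zero add by (rule SG.l_inv_ex)
  assume y: "y \<in> carrier total"
  show "x \<oplus>\<^bsub>total\<^esub> y \<in> carrier total"
    using x y unfolding carr add by (rule SG.m_closed)
  show "x \<oplus>\<^bsub>total\<^esub> y = y \<oplus>\<^bsub>total\<^esub> x"
    using x y by (auto simp: add_total component_closed G.m_comm)
  assume z: "z \<in> carrier total"
  show "x \<oplus>\<^bsub>total\<^esub> y \<oplus>\<^bsub>total\<^esub> z = x \<oplus>\<^bsub>total\<^esub> (y \<oplus>\<^bsub>total\<^esub> z)"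
    using x y z unfolding carr add by (rule SG.m_assoc)
qed

interpretation T: abelian_group total
  by (rule abelian_group_total)

lemma minus_total:
  assumes "x \<in> carrier total"
  shows "\<ominus>\<^bsub>total\<^esub> x = (\<lambda>n. inv\<^bsub>G n\<^esub> (x n))"
proof -
  have "(\<lambda>n. inv\<^bsub>G n\<^esub> (x n)) \<in> carrier total"
    using assms by (simp add: carrier_total)
  moreover have "(\<lambda>n. inv\<^bsub>G n\<^esub> (x n)) \<oplus>\<^bsub>total\<^esub> x = \<zero>\<^bsub>total\<^esub>"
    using assms by (simp add: add_total zero_total component_closed)
  ultimately show ?thesis
    using assms T.minus_equality by blast
qed

lemma homogeneous_closed: "a \<in> carrier (G n) \<Longrightarrow> homogeneous G n a \<in> carrier total"
  by (auto simp: carrier_total homogeneous_def intro: finite_subset[of _ "{n}"])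

lemma one_total_closed: "\<one>\<^bsub>total\<^esub> \<in> carrier total"
  by (simp add: one_total homogeneous_closed unit_closed)

lemma homogeneous_same: "homogeneous G n a n = a"
  by (simp add: homogeneous_def)

lemma homogeneous_one: "homogeneous G n \<one>\<^bsub>G n\<^esub> = \<zero>\<^bsub>total\<^esub>"
  by (auto simp: homogeneous_def zero_total)

text \<open>
  The index set in the definition of the product depends on both factors, so distributivity
  compares sums over different sets. Padding with zero summands replaces it by any finite set
  that contains the support of the left factor, and then one set serves for all terms.
\<close>

lemma mult_total:
  assumes x: "x \<in> carrier total" and y: "y \<in> carrier total"
    and I: "finite I" "{i. x i \<noteq> \<one>\<^bsub>G i\<^esub>} \<subseteq> I"
  shows "(x \<otimes>\<^bsub>total\<^esub> y) n = finprod (G n) (\<lambda>i. mul i (n - i) (x i) (y (n - i))) I"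
proof -
  have "finprod (G n) (\<lambda>i. mul i (n - i) (x i) (y (n - i)))
          {i. x i \<noteq> \<one>\<^bsub>G i\<^esub> \<and> y (n - i) \<noteq> \<one>\<^bsub>G (n - i)\<^esub>}
      = finprod (G n) (\<lambda>i. mul i (n - i) (x i) (y (n - i))) I"
  proof (rule G.finprod_mono_neutral_cong_left)
    show "mul i (n - i) (x i) (y (n - i)) = \<one>\<^bsub>G n\<^esub>"
      if "i \<in> I - {i. x i \<noteq> \<one>\<^bsub>G i\<^esub> \<and> y (n - i) \<noteq> \<one>\<^bsub>G (n - i)\<^esub>}" for i
      using that mul_one_left[OF component_closed[OF y], of i "n - i"]
        mul_one_right[OF component_closed[OF x], of i "n - i"] by auto
    show "(\<lambda>i. mul i (n - i) (x i) (y (n - i))) \<in> I \<rightarrow> carrier (G n)"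
      using x y by (simp add: mul_closed_at component_closed)
  qed (use I in auto)
  then show ?thesis
    by (simp add: graded_sum_def)
qed

text \<open>
  The product is supported on sums of degrees from the two supports, of which there are finitely
  many.
\<close>

lemma mult_total_closed:
  assumes x: "x \<in> carrier total" and y: "y \<in> carrier total"
  shows "x \<otimes>\<^bsub>total\<^esub> y \<in> carrier total"
proof -
  let ?X = "{i. x i \<noteq> \<one>\<^bsub>G i\<^esub>}" and ?Y = "{i. y i \<noteq> \<one>\<^bsub>G i\<^esub>}"
  have fin: "finite ?X" "finite ?Y"
    using x y by (simp_all add: carrier_total)
  have "(x \<otimes>\<^bsub>total\<^esub> y) n \<in> carrier (G n)" for n
    using x y by (simp add: mult_total[OF x y fin(1)] mul_closed_at component_closed)
  moreover have "{n. (x \<otimes>\<^bsub>total\<^esub> y) n \<noteq> \<one>\<^bsub>G n\<^esub>} \<subseteq> (\<lambda>(i, j). i + j) ` (?X \<times> ?Y)"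
  proof
    fix n assume n: "n \<in> {n. (x \<otimes>\<^bsub>total\<^esub> y) n \<noteq> \<one>\<^bsub>G n\<^esub>}"
    have "{i. x i \<noteq> \<one>\<^bsub>G i\<^esub> \<and> y (n - i) \<noteq> \<one>\<^bsub>G (n - i)\<^esub>} \<noteq> {}"
    proof
      assume empty: "{i. x i \<noteq> \<one>\<^bsub>G i\<^esub> \<and> y (n - i) \<noteq> \<one>\<^bsub>G (n - i)\<^esub>} = {}"
      show False
        using n by (simp add: graded_sum_def empty)
    qed
    then obtain i where "x i \<noteq> \<one>\<^bsub>G i\<^esub>" "y (n - i) \<noteq> \<one>\<^bsub>G (n - i)\<^esub>"
      by blast
    then show "n \<in> (\<lambda>(i, j). i + j) ` (?X \<times> ?Y)"
      by (intro image_eqI[of _ _ "(i, n - i)"]) auto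
  qed
  ultimately show ?thesis
    using fin finite_subset by (fastforce simp: carrier_total)
qed

lemma total_l_distr:
  assumes x: "x \<in> carrier total" and x': "x' \<in> carrier total" and y: "y \<in> carrier total"
  shows "(x \<oplus>\<^bsub>total\<^esub> x') \<otimes>\<^bsub>total\<^esub> y = x \<otimes>\<^bsub>total\<^esub> y \<oplus>\<^bsub>total\<^esub> x' \<otimes>\<^bsub>total\<^esub> y"
proof
  fix n
  define I where "I = {i. x i \<noteq> \<one>\<^bsub>G i\<^esub>} \<union> {i. x' i \<noteq> \<one>\<^bsub>G i\<^esub>}"
  have I: "finite I"
    using x x' by (simp add: I_def carrier_total)
  have sub: "{i. x i \<noteq> \<one>\<^bsub>G i\<^esub>} \<subseteq> I" "{i. x' i \<noteq> \<one>\<^bsub>G i\<^esub>} \<subseteq> I"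
    "{i. (x \<oplus>\<^bsub>total\<^esub> x') i \<noteq> \<one>\<^bsub>G i\<^esub>} \<subseteq> I"
    by (auto simp: I_def add_total)
  have "mul i (n - i) (x i \<otimes>\<^bsub>G i\<^esub> x' i) (y (n - i))
      = mul i (n - i) (x i) (y (n - i)) \<otimes>\<^bsub>G n\<^esub> mul i (n - i) (x' i) (y (n - i))" for i
    using mul_l_distr[of "x i" i "x' i" "y (n - i)" "n - i"] x x' y by (simp add: component_closed)
  then show "((x \<oplus>\<^bsub>total\<^esub> x') \<otimes>\<^bsub>total\<^esub> y) n = (x \<otimes>\<^bsub>total\<^esub> y \<oplus>\<^bsub>total\<^esub> x' \<otimes>\<^bsub>total\<^esub> y) n"
    using x x' y
    by (simp add: mult_total[OF T.add.m_closed[OF x x'] y I sub(3), unfolded add_total] mult_total[OF x y I sub(1)]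
        mult_total[OF x' y I sub(2)] add_total mul_closed_at component_closed)
qed

lemma total_r_distr:
  assumes x: "x \<in> carrier total" and y: "y \<in> carrier total" and y': "y' \<in> carrier total"
  shows "x \<otimes>\<^bsub>total\<^esub> (y \<oplus>\<^bsub>total\<^esub> y') = x \<otimes>\<^bsub>total\<^esub> y \<oplus>\<^bsub>total\<^esub> x \<otimes>\<^bsub>total\<^esub> y'"
proof
  fix n
  have I: "finite {i. x i \<noteq> \<one>\<^bsub>G i\<^esub>}"
    using x by (simp add: carrier_total)
  have "mul i (n - i) (x i) (y (n - i) \<otimes>\<^bsub>G (n - i)\<^esub> y' (n - i))
      = mul i (n - i) (x i) (y (n - i)) \<otimes>\<^bsub>G n\<^esub> mul i (n - i) (x i) (y' (n - i))" for i
    using mul_r_distr[of "x i" i "y (n - i)" "n - i" "y' (n - i)"] x y y'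
    by (simp add: component_closed)
  then show "(x \<otimes>\<^bsub>total\<^esub> (y \<oplus>\<^bsub>total\<^esub> y')) n = (x \<otimes>\<^bsub>total\<^esub> y \<oplus>\<^bsub>total\<^esub> x \<otimes>\<^bsub>total\<^esub> y') n"
    using x y y'
    by (simp add: mult_total[OF x T.add.m_closed[OF y y'] I, unfolded add_total] mult_total[OF x y I]
        mult_total[OF x y' I] add_total mul_closed_at component_closed)
qed

lemma mult_homogeneous:
  assumes a: "a \<in> carrier (G m)" and b: "b \<in> carrier (G n)"
  shows "homogeneous G m a \<otimes>\<^bsub>total\<^esub> homogeneous G n b = homogeneous G (m + n) (mul m n a b)"
proof
  fix k
  have "(homogeneous G m a \<otimes>\<^bsub>total\<^esub> homogeneous G n b) k
      = finprod (G k) (\<lambda>i. mul i (k - i) (homogeneous G m a i) (homogeneous G n b (k - i))) {m}"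
    by (rule mult_total[OF homogeneous_closed[OF a] homogeneous_closed[OF b]])
      (auto simp: homogeneous_def)
  also have "\<dots> = mul m (k - m) a (homogeneous G n b (k - m))"
    using a component_closed[OF homogeneous_closed[OF b], of "k - m"]
    by (simp add: homogeneous_same mul_closed_at)
  also have "\<dots> = homogeneous G (m + n) (mul m n a b) k"
    using mul_one_right[OF a, of "k - m"] by (auto simp: homogeneous_def)
  finally show "(homogeneous G m a \<otimes>\<^bsub>total\<^esub> homogeneous G n b) k
      = homogeneous G (m + n) (mul m n a b) k" .
qed

lemma finsum_total:
  assumes "finite I" "c \<in> I \<rightarrow> carrier total"
  shows "finsum total c I n = finprod (G n) (\<lambda>i. c i n) I"
  using assms
proof (induction I rule: finite_induct)
  case (insert a I)
  then have "(\<lambda>i. c i n) \<in> I \<rightarrow> carrier (G n)" "c a n \<in> carrier (G n)"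
    by (auto simp: component_closed Pi_iff)
  with insert show ?case
    by (simp add: add_total Pi_iff)
qed (simp add: zero_total)

lemma finsum_homogeneous:
  assumes "finite I" "\<And>n. a n \<in> carrier (G n)" "\<And>n. n \<notin> I \<Longrightarrow> a n = \<one>\<^bsub>G n\<^esub>"
  shows "(\<Oplus>\<^bsub>total\<^esub>n\<in>I. homogeneous G n (a n)) = a"
proof
  fix k
  have "(\<Oplus>\<^bsub>total\<^esub>n\<in>I. homogeneous G n (a n)) k
      = finprod (G k) (\<lambda>i. homogeneous G i (a i) k) I"
    using assms by (intro finsum_total) (auto simp: homogeneous_closed)
  also have "\<dots> = finprod (G k) (\<lambda>i. if k = i then a k else \<one>\<^bsub>G k\<^esub>) I"
    by (rule G.finprod_cong') (use assms in \<open>auto simp: homogeneous_def\<close>)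
  also have "\<dots> = a k"
  proof (cases "k \<in> I")
    case True
    then show ?thesis
      using assms G.finprod_singleton[of k I "\<lambda>_. a k" k] by simp
  next
    case False
    then have "finprod (G k) (\<lambda>i. if k = i then a k else \<one>\<^bsub>G k\<^esub>) I = \<one>\<^bsub>G k\<^esub>"
      by (intro G.finprod_one_eqI) auto
    then show ?thesis
      using False assms by simp
  qed
  finally show "(\<Oplus>\<^bsub>total\<^esub>n\<in>I. homogeneous G n (a n)) k = a k" .
qed

text \<open>
  An identity that is additive in each argument needs to be checked on homogeneous elements
  only. This avoids rearranging the double sums over degrees in the associative law.
\<close>

lemma total_induct [consumes 1, case_names zero homogeneous add]:
  assumes x: "x \<in> carrier total"
    and zero: "P \<zero>\<^bsub>total\<^esub>"
    and hom: "\<And>n a. a \<in> carrier (G n) \<Longrightarrow> P (homogeneous G n a)"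
    and add: "\<And>y z. \<lbrakk>y \<in> carrier total; z \<in> carrier total; P y; P z\<rbrakk> \<Longrightarrow> P (y \<oplus>\<^bsub>total\<^esub> z)"
  shows "P x"
proof -
  have "P (\<Oplus>\<^bsub>total\<^esub>n\<in>I. homogeneous G n (x n))" if "finite I" for I
    using that
  proof (induction I rule: finite_induct)
    case (insert a I)
    have "homogeneous G n (x n) \<in> carrier total" for n
      using x by (simp add: homogeneous_closed component_closed)
    with insert x show ?case
      by (simp add: Pi_iff add hom component_closed)
  qed (simp add: zero)
  then have "P (\<Oplus>\<^bsub>total\<^esub>n\<in>{n. x n \<noteq> \<one>\<^bsub>G n\<^esub>}. homogeneous G n (x n))"
    using x by (simp add: carrier_total)
  moreover have "(\<Oplus>\<^bsub>total\<^esub>n\<in>{n. x n \<noteq> \<one>\<^bsub>G n\<^esub>}. homogeneous G n (x n)) = x"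
    using x by (intro finsum_homogeneous) (auto simp: carrier_total)
  ultimately show ?thesis
    by simp
qed

lemma total_zero_mult:
  shows "\<zero>\<^bsub>total\<^esub> \<otimes>\<^bsub>total\<^esub> x = \<zero>\<^bsub>total\<^esub>" "x \<otimes>\<^bsub>total\<^esub> \<zero>\<^bsub>total\<^esub> = \<zero>\<^bsub>total\<^esub>"
  by (auto simp: graded_sum_def)

lemma total_assoc:
  assumes x: "x \<in> carrier total" and y: "y \<in> carrier total" and z: "z \<in> carrier total"
  shows "x \<otimes>\<^bsub>total\<^esub> y \<otimes>\<^bsub>total\<^esub> z = x \<otimes>\<^bsub>total\<^esub> (y \<otimes>\<^bsub>total\<^esub> z)"
  using x
proof (induction rule: total_induct)
  case zero
  then show ?case
    using y z by (simp add: total_zero_mult mult_total_closed)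
next
  case (add u v)
  then show ?case
    using y z by (simp add: total_l_distr mult_total_closed)
next
  case (homogeneous i a)
  note a = homogeneous homogeneous_closed[OF homogeneous]
  show ?case
    using y
  proof (induction rule: total_induct)
    case zero
    then show ?case
      using a z by (simp add: total_zero_mult)
  next
    case (add u v)
    then show ?case
      using a z by (simp add: total_l_distr total_r_distr mult_total_closed)
  next
    case (homogeneous j b)
    note b = homogeneous homogeneous_closed[OF homogeneous]
    show ?case
      using z
    proof (induction rule: total_induct)
      case zero
      then show ?case
        using a b by (simp add: total_zero_mult mult_total_closed)
    next
      case (add u v)
      then show ?case
        using a b by (simp add: total_r_distr mult_total_closed)
    next
      case (homogeneous k c)
      then show ?case
        using a b by (simp add: mult_homogeneous mul_closed mul_assoc add.assoc)
    qed
  qed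
qed

lemma total_unit:
  assumes "x \<in> carrier total"
  shows "\<one>\<^bsub>total\<^esub> \<otimes>\<^bsub>total\<^esub> x = x" "x \<otimes>\<^bsub>total\<^esub> \<one>\<^bsub>total\<^esub> = x"
proof -
  note one = one_total_closed
  have "\<one>\<^bsub>total\<^esub> \<otimes>\<^bsub>total\<^esub> x = x \<and> x \<otimes>\<^bsub>total\<^esub> \<one>\<^bsub>total\<^esub> = x"
    using assms
  proof (induction rule: total_induct)
    case zero
    show ?case
      using one by (simp add: total_zero_mult)
  next
    case (homogeneous n a)
    then show ?case
      by (simp add: one_total mult_homogeneous unit_closed unit_left unit_right)
  next
    case (add y z)
    then show ?case
      using one by (simp add: total_l_distr total_r_distr)
  qed
  then show "\<one>\<^bsub>total\<^esub> \<otimes>\<^bsub>total\<^esub> x = x" "x \<otimes>\<^bsub>total\<^esub> \<one>\<^bsub>total\<^esub> = x"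
    by auto
qed

lemma ring_total: "ring total"
proof (rule ringI)
  show "abelian_group total"
    by (rule abelian_group_total)
  show "monoid total"
    by (rule monoidI) (simp_all add: mult_total_closed total_assoc total_unit one_total_closed)
qed (simp_all add: total_l_distr total_r_distr)

lemma additive_subgroup_homogeneous:
  "additive_subgroup (homogeneous G n ` carrier (G n)) total"
proof (rule additive_subgroup.intro, rule T.add.subgroupI)
  fix x y
  assume "x \<in> homogeneous G n ` carrier (G n)"
  then obtain a where a: "x = homogeneous G n a" "a \<in> carrier (G n)"
    by blast
  have "\<ominus>\<^bsub>total\<^esub> x = homogeneous G n (inv\<^bsub>G n\<^esub> a)"
    using a by (auto simp: minus_total homogeneous_closed) (auto simp: homogeneous_def)
  then show "\<ominus>\<^bsub>total\<^esub> x \<in> homogeneous G n ` carrier (G n)"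
    using a by simp
  assume "y \<in> homogeneous G n ` carrier (G n)"
  then obtain b where b: "y = homogeneous G n b" "b \<in> carrier (G n)"
    by blast
  have "x \<oplus>\<^bsub>total\<^esub> y = homogeneous G n (a \<otimes>\<^bsub>G n\<^esub> b)"
    by (auto simp: a b add_total homogeneous_def)
  then show "x \<oplus>\<^bsub>total\<^esub> y \<in> homogeneous G n ` carrier (G n)"
    using a b by simp
qed (auto simp: homogeneous_closed)

text \<open>
  Existence is the decomposition into components. For uniqueness, the component of degree \<open>n\<close> of a
  sum of homogeneous elements, one in each degree, is the summand of degree \<open>n\<close>; so the sum
  determines its summands.
\<close>

lemma homogeneous_decomposition:
  assumes x: "x \<in> carrier total"
  shows "\<exists>!c. (\<forall>n. c n \<in> homogeneous G n ` carrier (G n)) \<and> finite {n. c n \<noteq> \<zero>\<^bsub>total\<^esub>}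
    \<and> x = (\<Oplus>\<^bsub>total\<^esub>n\<in>{n. c n \<noteq> \<zero>\<^bsub>total\<^esub>}. c n)"
proof -
  have nonzero: "homogeneous G n (a n) \<noteq> \<zero>\<^bsub>total\<^esub> \<longleftrightarrow> a n \<noteq> \<one>\<^bsub>G n\<^esub>" for n a
    by (metis homogeneous_one homogeneous_same)
  have sum: "(\<Oplus>\<^bsub>total\<^esub>n\<in>{n. homogeneous G n (a n) \<noteq> \<zero>\<^bsub>total\<^esub>}. homogeneous G n (a n)) = a"
    if "\<And>n. a n \<in> carrier (G n)" "finite {n. homogeneous G n (a n) \<noteq> \<zero>\<^bsub>total\<^esub>}" for a
    using that by (intro finsum_homogeneous) (auto simp: nonzero)
  show ?thesis
  proof (rule ex1I[of _ "\<lambda>n. homogeneous G n (x n)"])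
    have "finite {n. homogeneous G n (x n) \<noteq> \<zero>\<^bsub>total\<^esub>}"
      using x by (simp add: nonzero carrier_total)
    then show "(\<forall>n. homogeneous G n (x n) \<in> homogeneous G n ` carrier (G n))
        \<and> finite {n. homogeneous G n (x n) \<noteq> \<zero>\<^bsub>total\<^esub>}
        \<and> x = (\<Oplus>\<^bsub>total\<^esub>n\<in>{n. homogeneous G n (x n) \<noteq> \<zero>\<^bsub>total\<^esub>}. homogeneous G n (x n))"
      using x by (simp add: sum component_closed)
  next
    fix c
    assume c: "(\<forall>n. c n \<in> homogeneous G n ` carrier (G n)) \<and> finite {n. c n \<noteq> \<zero>\<^bsub>total\<^esub>}
      \<and> x = (\<Oplus>\<^bsub>total\<^esub>n\<in>{n. c n \<noteq> \<zero>\<^bsub>total\<^esub>}. c n)"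
    then have "\<forall>n. \<exists>b. c n = homogeneous G n b \<and> b \<in> carrier (G n)"
      by blast
    then obtain a where "\<forall>n. c n = homogeneous G n (a n) \<and> a n \<in> carrier (G n)"
      by metis
    then have a: "c = (\<lambda>n. homogeneous G n (a n))" "\<And>n. a n \<in> carrier (G n)"
      by auto
    then have "x = a"
      using c sum[of a] by simp
    then show "c = (\<lambda>n. homogeneous G n (x n))"
      using a by simp
  qed
qed

theorem graded_ring_total: "graded_ring total (\<lambda>n. homogeneous G n ` carrier (G n))"
proof (intro graded_ring.intro graded_ring_axioms.intro)
  show "\<one>\<^bsub>total\<^esub> \<in> homogeneous G 0 ` carrier (G 0)"
    by (simp add: one_total unit_closed)
  show "x \<otimes>\<^bsub>total\<^esub> y \<in> homogeneous G (m + n) ` carrier (G (m + n))"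
    if "x \<in> homogeneous G m ` carrier (G m)" "y \<in> homogeneous G n ` carrier (G n)" for x y m n
    using that by (auto simp: mult_homogeneous mul_closed)
qed (simp_all add: ring_total additive_subgroup_homogeneous homogeneous_decomposition)

end

section \<open>Graded subrings and their quotients\<close>

locale graded_subproduct = graded_product G mul e
  for G :: "int \<Rightarrow> ('c, 'm) monoid_scheme" and mul e +
  fixes S :: "int \<Rightarrow> 'c set"
  assumes sub_subgroup: "subgroup (S n) (G n)"
    and sub_mul_closed: "\<lbrakk>x \<in> S i; y \<in> S j\<rbrakk> \<Longrightarrow> mul i j x y \<in> S (i + j)"
    and sub_unit: "e \<in> S 0"
begin

definition sub_total :: "(int \<Rightarrow> 'c) set"
  where "sub_total = {x \<in> carrier total. \<forall>n. x n \<in> S n}"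

interpretation G: comm_group "G n" for n
  by (rule component_comm_group)

lemma sub_in_carrier: "x \<in> S n \<Longrightarrow> x \<in> carrier (G n)"
  by (rule subgroup.mem_carrier[OF sub_subgroup])

lemma sub_component_group: "comm_group ((G n)\<lparr>carrier := S n\<rparr>)"
proof (rule group.group_comm_groupI)
  show "group ((G n)\<lparr>carrier := S n\<rparr>)"
    by (rule subgroup.subgroup_is_group[OF sub_subgroup]) (rule G.is_group)
qed (simp add: sub_in_carrier G.m_comm)

text \<open>
  This is what makes the components of a product of two elements of the subring lie in the
  subring: they are finite sums of products of components.
\<close>

lemma sub_finprod_closed:
  assumes "finite I" "f \<in> I \<rightarrow> S n"
  shows "finprod (G n) f I \<in> S n"
  using assms
proof (induction I rule: finite_induct)
  case empty
  then show ?case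
    using subgroup.one_closed[OF sub_subgroup] by simp
next
  case (insert a I)
  then show ?case
    using subgroup.m_closed[OF sub_subgroup] by (simp add: Pi_iff sub_in_carrier)
qed

lemma sub_mul_closed_at: "\<lbrakk>x \<in> S i; y \<in> S (n - i)\<rbrakk> \<Longrightarrow> mul i (n - i) x y \<in> S n"
  using sub_mul_closed[of x i y "n - i"] by simp

lemma subring_sub_total: "subring sub_total total"
proof (rule ring.subringI[OF ring_total])
  show "\<one>\<^bsub>total\<^esub> \<in> sub_total"
    using homogeneous_closed[OF unit_closed] subgroup.one_closed[OF sub_subgroup] sub_unit
    by (auto simp: sub_total_def one_total homogeneous_def)
  fix x y
  assume x: "x \<in> sub_total"
  then show "\<ominus>\<^bsub>total\<^esub> x \<in> sub_total"
    using abelian_group.a_inv_closed[OF abelian_group_total, of x]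
      subgroup.m_inv_closed[OF sub_subgroup]
    by (auto simp: sub_total_def minus_total)
  assume y: "y \<in> sub_total"
  show "x \<oplus>\<^bsub>total\<^esub> y \<in> sub_total"
    using x y abelian_monoid.a_closed[OF abelian_group.axioms(1)[OF abelian_group_total], of x y]
      subgroup.m_closed[OF sub_subgroup]
    by (auto simp: sub_total_def add_total)
  have "finite {i. x i \<noteq> \<one>\<^bsub>G i\<^esub>}"
    using x by (simp add: sub_total_def carrier_total)
  then have "(x \<otimes>\<^bsub>total\<^esub> y) n \<in> S n" for n
    using x y
    by (subst mult_total) (auto simp: sub_total_def intro!: sub_finprod_closed sub_mul_closed_at)
  then show "x \<otimes>\<^bsub>total\<^esub> y \<in> sub_total"
    using x y by (simp add: sub_total_def mult_total_closed)
qed (auto simp: sub_total_def)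

text \<open>
  Applying \<open>\<phi> n\<close> can turn nonzero components into zero, so the two sums that define a product
  and its image run over different sets; both are compared on the support of the left factor.
\<close>

lemma componentwise_ring_hom:
  fixes G' :: "int \<Rightarrow> ('d, 'k) monoid_scheme" and mul' and e'
  assumes G': "graded_product G' mul' e'"
    and hom: "\<And>n. \<phi> n \<in> hom ((G n)\<lparr>carrier := S n\<rparr>) (G' n)"
    and mul: "\<And>i j x y. \<lbrakk>x \<in> S i; y \<in> S j\<rbrakk> \<Longrightarrow> \<phi> (i + j) (mul i j x y) = mul' i j (\<phi> i x) (\<phi> j y)"
    and unit: "\<phi> 0 e = e'"
  shows "(\<lambda>x n. \<phi> n (x n)) \<in> ring_hom (total\<lparr>carrier := sub_total\<rparr>) (graded_sum G' mul' e')"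
proof -
  interpret G': graded_product G' mul' e'
    by (rule G')
  interpret G'n: comm_group "G' n" for n
    by (rule G'.component_comm_group)
  have closed: "\<phi> n x \<in> carrier (G' n)" if "x \<in> S n" for n x
    using hom[of n] that by (auto simp: hom_def)
  have mult: "\<phi> n (x \<otimes>\<^bsub>G n\<^esub> y) = \<phi> n x \<otimes>\<^bsub>G' n\<^esub> \<phi> n y" if "x \<in> S n" "y \<in> S n" for n x y
    using hom[of n] that by (auto simp: hom_def)
  have one: "\<phi> n \<one>\<^bsub>G n\<^esub> = \<one>\<^bsub>G' n\<^esub>" for n
    using hom_one[OF hom[of n]] comm_group.axioms(2)[OF sub_component_group] by simp
  have finprod: "\<phi> n (finprod (G n) f I) = finprod (G' n) (\<lambda>i. \<phi> n (f i)) I"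
    if "finite I" "f \<in> I \<rightarrow> S n" for n f I
    using that
  proof (induction I rule: finite_induct)
    case (insert a I)
    then show ?case
      by (simp add: Pi_iff mult sub_finprod_closed closed sub_in_carrier)
  qed (simp add: one)
  have total_closed: "(\<lambda>n. \<phi> n (x n)) \<in> carrier G'.total" if "x \<in> sub_total" for x
  proof -
    have "finite {n. x n \<noteq> \<one>\<^bsub>G n\<^esub>}"
      using that by (simp add: sub_total_def carrier_total)
    then have "finite {n. \<phi> n (x n) \<noteq> \<one>\<^bsub>G' n\<^esub>}"
      by (rule rev_finite_subset) (auto simp: one)
    then show ?thesis
      using that by (simp add: G'.carrier_total closed sub_total_def)
  qed
  show ?thesis
  proof (rule ring_hom_memI; simp)
    fix x assume x: "x \<in> sub_total"
    then show "(\<lambda>n. \<phi> n (x n)) \<in> carrier G'.total"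
      by (rule total_closed)
    fix y assume y: "y \<in> sub_total"
    show "(\<lambda>n. \<phi> n ((x \<oplus>\<^bsub>total\<^esub> y) n)) = (\<lambda>n. \<phi> n (x n)) \<oplus>\<^bsub>G'.total\<^esub> (\<lambda>n. \<phi> n (y n))"
      using x y by (auto simp: add_total G'.add_total sub_total_def mult)
    show "(\<lambda>n. \<phi> n ((x \<otimes>\<^bsub>total\<^esub> y) n)) = (\<lambda>n. \<phi> n (x n)) \<otimes>\<^bsub>G'.total\<^esub> (\<lambda>n. \<phi> n (y n))"
    proof
      fix n
      let ?I = "{i. x i \<noteq> \<one>\<^bsub>G i\<^esub>}"
      have carr: "x \<in> carrier total" "y \<in> carrier total"
        and sub: "\<And>i. x i \<in> S i" "\<And>i. y i \<in> S i"
        using x y by (simp_all add: sub_total_def)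
      have I: "finite ?I" "{i. \<phi> i (x i) \<noteq> \<one>\<^bsub>G' i\<^esub>} \<subseteq> ?I"
        using carr by (auto simp: carrier_total one)
      have "\<phi> n ((x \<otimes>\<^bsub>total\<^esub> y) n)
          = finprod (G' n) (\<lambda>i. \<phi> n (mul i (n - i) (x i) (y (n - i)))) ?I"
        using I by (simp add: mult_total[OF carr I(1)] finprod sub sub_mul_closed_at)
      also have "\<dots> = finprod (G' n) (\<lambda>i. mul' i (n - i) (\<phi> i (x i)) (\<phi> (n - i) (y (n - i)))) ?I"
      proof (rule G'n.finprod_cong')
        show "\<phi> n (mul i (n - i) (x i) (y (n - i))) = mul' i (n - i) (\<phi> i (x i)) (\<phi> (n - i) (y (n - i)))"
          for i
          using mul[OF sub, of i "n - i"] by simp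
      qed (simp_all add: G'.mul_closed_at closed sub)
      also have "\<dots> = ((\<lambda>n. \<phi> n (x n)) \<otimes>\<^bsub>G'.total\<^esub> (\<lambda>n. \<phi> n (y n))) n"
        by (rule G'.mult_total[OF total_closed[OF x] total_closed[OF y] I, symmetric])
      finally show "\<phi> n ((x \<otimes>\<^bsub>total\<^esub> y) n)
          = ((\<lambda>n. \<phi> n (x n)) \<otimes>\<^bsub>G'.total\<^esub> (\<lambda>n. \<phi> n (y n))) n" .
    qed
  next
    show "(\<lambda>n. \<phi> n (\<one>\<^bsub>total\<^esub> n)) = \<one>\<^bsub>G'.total\<^esub>"
      by (auto simp: one_total G'.one_total homogeneous_def unit one)
  qed
qed

end

text \<open>
  Here \<open>S\<close> is a graded subring and \<open>B\<close> a graded two-sided ideal of \<open>S\<close>, in general not of the whole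
  ring: a product of a coboundary with an arbitrary map is in general not even a cocycle. The
  elements of \<open>B\<close> are called null.
\<close>

locale graded_subquotient = graded_subproduct G mul e S
  for G :: "int \<Rightarrow> ('c, 'm) monoid_scheme" and mul e S +
  fixes B :: "int \<Rightarrow> 'c set"
  assumes null_subgroup: "subgroup (B n) ((G n)\<lparr>carrier := S n\<rparr>)"
    and null_mul_left: "\<lbrakk>b \<in> B i; y \<in> S j\<rbrakk> \<Longrightarrow> mul i j b y \<in> B (i + j)"
    and null_mul_right: "\<lbrakk>x \<in> S i; b \<in> B j\<rbrakk> \<Longrightarrow> mul i j x b \<in> B (i + j)"
begin

definition quotient :: "int \<Rightarrow> 'c set monoid"
  where "quotient n = (G n)\<lparr>carrier := S n\<rparr> Mod B n"

definition residue :: "int \<Rightarrow> 'c \<Rightarrow> 'c set"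
  where "residue n x = B n #>\<^bsub>G n\<^esub> x"

definition residue_mul :: "int \<Rightarrow> int \<Rightarrow> 'c set \<Rightarrow> 'c set \<Rightarrow> 'c set"
  where "residue_mul m n U V = (\<Union>x\<in>U. \<Union>y\<in>V. residue (m + n) (mul m n x y))"

interpretation G: comm_group "G n" for n
  by (rule component_comm_group)

interpretation S: comm_group "(G n)\<lparr>carrier := S n\<rparr>" for n
  by (rule sub_component_group)

lemma null_in_sub: "b \<in> B n \<Longrightarrow> b \<in> S n"
  using subgroup.mem_carrier[OF null_subgroup, of b n] by simp

lemma residue_eq_coset: "residue n x = B n #>\<^bsub>(G n)\<lparr>carrier := S n\<rparr>\<^esub> x"
  by (simp add: residue_def r_coset_def)

lemma mem_residue: "x' \<in> residue n x \<longleftrightarrow> (\<exists>b\<in>B n. x' = b \<otimes>\<^bsub>G n\<^esub> x)"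
  by (auto simp: residue_def r_coset_def)

lemma residue_eqI: "\<lbrakk>x \<in> S n; x' \<in> residue n x\<rbrakk> \<Longrightarrow> residue n x' = residue n x"
  using S.repr_independence[OF _ _ null_subgroup, THEN sym] by (simp add: residue_eq_coset)

lemma residue_self: "x \<in> S n \<Longrightarrow> x \<in> residue n x"
  using S.rcos_self[OF _ null_subgroup] by (simp add: residue_eq_coset)

lemma residue_subset: "x \<in> S n \<Longrightarrow> residue n x \<subseteq> S n"
  using subgroup.m_closed[OF sub_subgroup] by (auto simp: mem_residue null_in_sub)

lemma carrier_quotient: "carrier (quotient n) = residue n ` S n"
  by (auto simp: quotient_def FactGroup_def RCOSETS_def residue_eq_coset)

text \<open>
  For null elements \<open>b\<close> and \<open>c\<close>, the product of the representatives \<open>b + x\<close> and \<open>c + y\<close> differs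
  from \<open>x y\<close> by \<open>b (c + y) + x c\<close>, which is null because null elements form an ideal.
\<close>

lemma residue_mul_cong:
  assumes x: "x \<in> S m" "x' \<in> residue m x" and y: "y \<in> S n" "y' \<in> residue n y"
  shows "residue (m + n) (mul m n x' y') = residue (m + n) (mul m n x y)"
proof (rule residue_eqI)
  show "mul m n x y \<in> S (m + n)"
    using x y by (simp add: sub_mul_closed)
  obtain b where b: "b \<in> B m" "x' = b \<otimes>\<^bsub>G m\<^esub> x"
    using x by (auto simp: mem_residue)
  obtain c where c: "c \<in> B n" "y' = c \<otimes>\<^bsub>G n\<^esub> y"
    using y by (auto simp: mem_residue)
  have y': "y' \<in> S n"
    using y residue_subset by blast
  have null: "mul m n b y' \<in> B (m + n)" "mul m n x c \<in> B (m + n)"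
    using b c x y' by (simp_all add: null_mul_left null_mul_right)
  have "mul m n x' y' = mul m n b y' \<otimes>\<^bsub>G (m + n)\<^esub> mul m n x y'"
    using b x y' by (simp add: mul_l_distr null_in_sub sub_in_carrier)
  also have "mul m n x y' = mul m n x c \<otimes>\<^bsub>G (m + n)\<^esub> mul m n x y"
    using c x y by (simp add: mul_r_distr null_in_sub sub_in_carrier)
  finally have "mul m n x' y'
      = (mul m n b y' \<otimes>\<^bsub>G (m + n)\<^esub> mul m n x c) \<otimes>\<^bsub>G (m + n)\<^esub> mul m n x y"
    using null x y by (simp add: G.m_assoc null_in_sub sub_in_carrier mul_closed)
  moreover have "mul m n b y' \<otimes>\<^bsub>G (m + n)\<^esub> mul m n x c \<in> B (m + n)"
    using subgroup.m_closed[OF null_subgroup null] by simp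
  ultimately show "mul m n x' y' \<in> residue (m + n) (mul m n x y)"
    unfolding mem_residue by blast
qed

lemma residue_mul_residue:
  assumes x: "x \<in> S m" and y: "y \<in> S n"
  shows "residue_mul m n (residue m x) (residue n y) = residue (m + n) (mul m n x y)"
proof -
  have "residue (m + n) (mul m n x' y') = residue (m + n) (mul m n x y)"
    if "x' \<in> residue m x" "y' \<in> residue n y" for x' y'
    using x y that by (intro residue_mul_cong)
  moreover have "residue m x \<noteq> {}" "residue n y \<noteq> {}"
    using residue_self[OF x] residue_self[OF y] by auto
  ultimately show ?thesis
    by (simp add: residue_mul_def)
qed

lemma residue_hom: "residue n \<in> hom ((G n)\<lparr>carrier := S n\<rparr>) (quotient n)"
proof -
  interpret normal "B n" "(G n)\<lparr>carrier := S n\<rparr>"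
    by (rule S.subgroup_imp_normal[OF null_subgroup])
  show ?thesis
    using r_coset_hom_Mod by (simp add: quotient_def residue_eq_coset[abs_def])
qed

lemma quotient_mult:
  "\<lbrakk>x \<in> S n; y \<in> S n\<rbrakk> \<Longrightarrow> residue n x \<otimes>\<^bsub>quotient n\<^esub> residue n y = residue n (x \<otimes>\<^bsub>G n\<^esub> y)"
  using hom_mult[OF residue_hom, of x n y] by simp

text \<open>
  By \<open>residue_mul_residue\<close>, products of classes are computed on representatives, so each axiom is
  inherited from the subring.
\<close>

theorem graded_product_quotient: "graded_product quotient residue_mul (residue 0 e)"
proof (rule graded_product.intro)
  show "comm_group (quotient n)" for n
    unfolding quotient_def by (rule S.abelian_FactGroup[OF null_subgroup])
next
  fix U V i j
  assume "U \<in> carrier (quotient i)" "V \<in> carrier (quotient j)"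
  then show "residue_mul i j U V \<in> carrier (quotient (i + j))"
    by (auto simp: carrier_quotient residue_mul_residue sub_mul_closed)
next
  fix U U' V i j
  assume "U \<in> carrier (quotient i)" "U' \<in> carrier (quotient i)" "V \<in> carrier (quotient j)"
  then show "residue_mul i j (U \<otimes>\<^bsub>quotient i\<^esub> U') V
      = residue_mul i j U V \<otimes>\<^bsub>quotient (i + j)\<^esub> residue_mul i j U' V"
    using subgroup.m_closed[OF sub_subgroup]
    by (auto simp: carrier_quotient residue_mul_residue sub_mul_closed quotient_mult mul_l_distr
        sub_in_carrier)
next
  fix U V V' i j
  assume "U \<in> carrier (quotient i)" "V \<in> carrier (quotient j)" "V' \<in> carrier (quotient j)"
  then show "residue_mul i j U (V \<otimes>\<^bsub>quotient j\<^esub> V')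
      = residue_mul i j U V \<otimes>\<^bsub>quotient (i + j)\<^esub> residue_mul i j U V'"
    using subgroup.m_closed[OF sub_subgroup]
    by (auto simp: carrier_quotient residue_mul_residue sub_mul_closed quotient_mult mul_r_distr
        sub_in_carrier)
next
  fix U V W i j k
  assume "U \<in> carrier (quotient i)" "V \<in> carrier (quotient j)" "W \<in> carrier (quotient k)"
  then show "residue_mul (i + j) k (residue_mul i j U V) W = residue_mul i (j + k) U (residue_mul j k V W)"
    by (auto simp: carrier_quotient residue_mul_residue sub_mul_closed mul_assoc sub_in_carrier
        add.assoc)
next
  show "residue 0 e \<in> carrier (quotient 0)"
    by (simp add: carrier_quotient sub_unit)
next
  fix U n
  assume "U \<in> carrier (quotient n)"
  then show "residue_mul 0 n (residue 0 e) U = U" "residue_mul n 0 U (residue 0 e) = U"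
    using residue_mul_residue[OF sub_unit] residue_mul_residue[OF _ sub_unit]
    by (auto simp: carrier_quotient unit_left unit_right sub_in_carrier)
qed

corollary residue_ring_hom:
  "(\<lambda>x n. residue n (x n))
    \<in> ring_hom (total\<lparr>carrier := sub_total\<rparr>) (graded_sum quotient residue_mul (residue 0 e))"
  by (rule componentwise_ring_hom[OF graded_product_quotient residue_hom])
    (simp_all add: residue_mul_residue)

end

section \<open>The graded commutator with a square-zero element of degree one\<close>

text \<open>
  The model is the endomorphism algebra of a complex, with \<open>D\<close> the differential of the complex.
\<close>

locale inner_differential = graded_product G mul e
  for G :: "int \<Rightarrow> ('c, 'm) monoid_scheme" and mul e +
  fixes D :: 'c
  assumes D_closed: "D \<in> carrier (G 1)"
    and D_squared: "mul 1 1 D D = \<one>\<^bsub>G 2\<^esub>"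
begin

text \<open>
  The factor \<open>(-1)\<^sup>n\<close> acting on the component of degree \<open>k\<close>; the inverse is the negation of the
  additive group.
\<close>

definition signed :: "int \<Rightarrow> int \<Rightarrow> 'c \<Rightarrow> 'c"
  where "signed n k x = (if even n then x else inv\<^bsub>G k\<^esub> x)"

text \<open>
  The graded commutator \<open>D f - (-1)\<^sup>n f D\<close> for \<open>f\<close> of degree \<open>n\<close>.
\<close>

definition bracket :: "int \<Rightarrow> 'c \<Rightarrow> 'c"
  where "bracket n f = mul 1 n D f \<otimes>\<^bsub>G (n + 1)\<^esub> inv\<^bsub>G (n + 1)\<^esub> signed n (n + 1) (mul n 1 f D)"

definition bracket_kernel :: "int \<Rightarrow> 'c set"
  where "bracket_kernel n = kernel (G n) (G (n + 1)) (bracket n)"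

definition bracket_image :: "int \<Rightarrow> 'c set"
  where "bracket_image n = bracket (n - 1) ` carrier (G (n - 1))"

interpretation G: comm_group "G n" for n
  by (rule component_comm_group)

lemma mul_inv_left:
  assumes x: "x \<in> carrier (G i)" and y: "y \<in> carrier (G j)"
  shows "mul i j (inv\<^bsub>G i\<^esub> x) y = inv\<^bsub>G (i + j)\<^esub> mul i j x y"
proof -
  have "mul i j (inv\<^bsub>G i\<^esub> x) y \<otimes>\<^bsub>G (i + j)\<^esub> mul i j x y = \<one>\<^bsub>G (i + j)\<^esub>"
    using mul_l_distr[of "inv\<^bsub>G i\<^esub> x" i x y j] mul_one_left[OF y, of i] x y by simp
  then show ?thesis
    using x y by (simp add: G.inv_equality mul_closed)
qed

lemma mul_inv_right:
  assumes x: "x \<in> carrier (G i)" and y: "y \<in> carrier (G j)"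
  shows "mul i j x (inv\<^bsub>G j\<^esub> y) = inv\<^bsub>G (i + j)\<^esub> mul i j x y"
proof -
  have "mul i j x (inv\<^bsub>G j\<^esub> y) \<otimes>\<^bsub>G (i + j)\<^esub> mul i j x y = \<one>\<^bsub>G (i + j)\<^esub>"
    using mul_r_distr[of x i "inv\<^bsub>G j\<^esub> y" j y] mul_one_right[OF x, of j] x y by simp
  then show ?thesis
    using x y by (simp add: G.inv_equality mul_closed)
qed

lemma D_mul_closed:
  assumes "f \<in> carrier (G n)"
  shows "mul 1 n D f \<in> carrier (G (n + 1))" "mul n 1 f D \<in> carrier (G (n + 1))"
  using mul_closed[OF D_closed assms] mul_closed[OF assms D_closed] by (simp_all add: add.commute)

lemma signed_closed: "x \<in> carrier (G k) \<Longrightarrow> signed n k x \<in> carrier (G k)"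
  by (simp add: signed_def)

lemma bracket_closed: "f \<in> carrier (G n) \<Longrightarrow> bracket n f \<in> carrier (G (n + 1))"
  by (simp add: bracket_def D_mul_closed signed_closed)

lemma bracket_mult:
  assumes f: "f \<in> carrier (G n)" and g: "g \<in> carrier (G n)"
  shows "bracket n (f \<otimes>\<^bsub>G n\<^esub> g) = bracket n f \<otimes>\<^bsub>G (n + 1)\<^esub> bracket n g"
proof -
  have "mul 1 n D (f \<otimes>\<^bsub>G n\<^esub> g) = mul 1 n D f \<otimes>\<^bsub>G (n + 1)\<^esub> mul 1 n D g"
    using mul_r_distr[OF D_closed f g] by (simp add: add.commute)
  moreover have "mul n 1 (f \<otimes>\<^bsub>G n\<^esub> g) D = mul n 1 f D \<otimes>\<^bsub>G (n + 1)\<^esub> mul n 1 g D"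
    using mul_l_distr[OF f g D_closed] .
  ultimately show ?thesis
    using D_mul_closed[OF f] D_mul_closed[OF g]
    by (simp add: bracket_def signed_def G.inv_mult G.m_ac)
qed

lemma bracket_group_hom: "group_hom (G n) (G (n + 1)) (bracket n)"
  by (intro group_hom.intro group_hom_axioms.intro G.is_group homI bracket_closed bracket_mult)

text \<open>
  Both sides are signed sums of the words \<open>D f g\<close>, \<open>f D g\<close> and \<open>f g D\<close>. The word \<open>f D g\<close> occurs
  twice on the right, as \<open>- (-1)\<^sup>m f D g\<close> from the commutator with \<open>f\<close> and as \<open>(-1)\<^sup>m f D g\<close> from
  the commutator with \<open>g\<close>, and cancels.
\<close>

lemma bracket_leibniz:
  assumes f: "f \<in> carrier (G m)" and g: "g \<in> carrier (G n)"
  shows "bracket (m + n) (mul m n f g) =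
    mul (m + 1) n (bracket m f) g \<otimes>\<^bsub>G (m + n + 1)\<^esub>
      signed m (m + n + 1) (mul m (n + 1) f (bracket n g))"
proof -
  have degs: "m + 1 + n = m + n + 1" "m + (n + 1) = m + n + 1" "1 + m = m + 1" "1 + n = n + 1"
    "1 + (m + n) = m + n + 1"
    by simp_all
  define u where "u = mul 1 (m + n) D (mul m n f g)"
  define v where "v = mul m (n + 1) f (mul 1 n D g)"
  define w where "w = mul (m + n) 1 (mul m n f g) D"
  have closed: "u \<in> carrier (G (m + n + 1))" "v \<in> carrier (G (m + n + 1))"
    "w \<in> carrier (G (m + n + 1))"
    using D_mul_closed[OF mul_closed[OF f g]] mul_closed[OF f D_mul_closed(1)[OF g]]
    by (simp_all add: u_def v_def w_def degs)
  have cancel: "v \<otimes>\<^bsub>G (m + n + 1)\<^esub> (inv\<^bsub>G (m + n + 1)\<^esub> v \<otimes>\<^bsub>G (m + n + 1)\<^esub> z) = z"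
    "inv\<^bsub>G (m + n + 1)\<^esub> v \<otimes>\<^bsub>G (m + n + 1)\<^esub> (v \<otimes>\<^bsub>G (m + n + 1)\<^esub> z) = z"
    if "z \<in> carrier (G (m + n + 1))" for z
    using that closed by (simp_all flip: G.m_assoc)
  have u: "mul (m + 1) n (mul 1 m D f) g = u"
    using mul_assoc[OF D_closed f g] by (simp add: u_def degs)
  have v: "mul (m + 1) n (mul m 1 f D) g = v"
    using mul_assoc[OF f D_closed g] by (simp add: v_def degs)
  have w: "mul m (n + 1) f (mul n 1 g D) = w"
    using mul_assoc[OF f g D_closed] by (simp add: w_def degs)
  have l: "mul (m + 1) n (bracket m f) g = u \<otimes>\<^bsub>G (m + n + 1)\<^esub> inv\<^bsub>G (m + n + 1)\<^esub> signed m (m + n + 1) v"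
    using D_mul_closed[OF f] g mul_l_distr[of _ "m + 1" _ g n] mul_inv_left[of _ "m + 1" g n]
    by (simp add: bracket_def signed_def u v degs)
  have r: "mul m (n + 1) f (bracket n g) = v \<otimes>\<^bsub>G (m + n + 1)\<^esub> inv\<^bsub>G (m + n + 1)\<^esub> signed n (m + n + 1) w"
    using D_mul_closed[OF g] f mul_r_distr[of f m _ "n + 1"] mul_inv_right[of f m _ "n + 1"]
    by (simp add: bracket_def signed_def w degs flip: v_def)
  have "bracket (m + n) (mul m n f g)
      = u \<otimes>\<^bsub>G (m + n + 1)\<^esub> inv\<^bsub>G (m + n + 1)\<^esub> signed (m + n) (m + n + 1) w"
    by (simp add: bracket_def u_def w_def)
  also have "\<dots> = mul (m + 1) n (bracket m f) g \<otimes>\<^bsub>G (m + n + 1)\<^esub>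
      signed m (m + n + 1) (mul m (n + 1) f (bracket n g))"
    unfolding l r using closed
    by (auto simp: signed_def G.m_assoc G.inv_mult cancel)
  finally show ?thesis .
qed

text \<open>
  The words \<open>D D f\<close> and \<open>f D D\<close> vanish. The remaining word \<open>D f D\<close> occurs once with the sign
  belonging to \<open>n\<close> and once with the sign belonging to \<open>n + 1\<close>, and these are opposite.
\<close>

lemma bracket_bracket:
  assumes f: "f \<in> carrier (G n)"
  shows "bracket (n + 1) (bracket n f) = \<one>\<^bsub>G (n + 2)\<^esub>"
proof -
  have degs: "1 + n = n + 1" "n + 1 + 1 = n + 2" "1 + (n + 1) = n + 2" "(1::int) + 1 = 2" "2 + n = n + 2"
    by simp_all
  define u where "u = mul 1 (n + 1) D (mul n 1 f D)"
  have u: "u \<in> carrier (G (n + 2))" "mul (n + 1) 1 (mul 1 n D f) D = u"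
    using mul_closed[OF D_closed D_mul_closed(2)[OF f]] mul_assoc[OF D_closed f D_closed]
    by (simp_all add: u_def degs)
  have DDf: "mul 1 (n + 1) D (mul 1 n D f) = \<one>\<^bsub>G (n + 2)\<^esub>"
    using mul_assoc[OF D_closed D_closed f] mul_one_left[OF f, of 2] by (simp add: D_squared degs)
  have fDD: "mul (n + 1) 1 (mul n 1 f D) D = \<one>\<^bsub>G (n + 2)\<^esub>"
    using mul_assoc[OF f D_closed D_closed] mul_one_right[OF f, of 2] by (simp add: D_squared degs)
  have l: "mul 1 (n + 1) D (bracket n f) = inv\<^bsub>G (n + 2)\<^esub> signed n (n + 2) u"
    using D_mul_closed[OF f] mul_r_distr[OF D_closed, of _ "n + 1"] u
      mul_inv_right[OF D_closed, of _ "n + 1"] D_closed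
    by (simp add: bracket_def signed_def DDf degs flip: u_def)
  have r: "mul (n + 1) 1 (bracket n f) D = u"
    using D_mul_closed[OF f] mul_l_distr[OF _ _ D_closed, of _ "n + 1"] u
      mul_inv_left[OF _ D_closed, of _ "n + 1"] D_closed
    by (simp add: bracket_def signed_def fDD degs)
  show ?thesis
    using u by (simp add: bracket_def[of "n + 1"] l r degs) (simp add: signed_def)
qed

lemma bracket_kernel_iff:
  "f \<in> bracket_kernel n \<longleftrightarrow> f \<in> carrier (G n) \<and> bracket n f = \<one>\<^bsub>G (n + 1)\<^esub>"
  by (simp add: bracket_kernel_def kernel_def)

lemma subgroup_bracket_kernel: "subgroup (bracket_kernel n) (G n)"
  unfolding bracket_kernel_def by (rule group_hom.subgroup_kernel[OF bracket_group_hom])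

lemma subgroup_bracket_image: "subgroup (bracket_image n) (G n)"
  using group_hom.img_is_subgroup[OF bracket_group_hom, of "n - 1"] by (simp add: bracket_image_def)

lemma bracket_image_subset_kernel: "bracket_image n \<subseteq> bracket_kernel n"
proof
  fix b assume "b \<in> bracket_image n"
  then obtain h where "h \<in> carrier (G (n - 1))" "b = bracket (n - 1) h"
    by (auto simp: bracket_image_def)
  then show "b \<in> bracket_kernel n"
    using bracket_closed[of h "n - 1"] bracket_bracket[of h "n - 1"]
    by (simp add: bracket_kernel_iff add.commute)
qed

lemma bracket_kernel_mul:
  assumes "f \<in> bracket_kernel m" "g \<in> bracket_kernel n"
  shows "mul m n f g \<in> bracket_kernel (m + n)"
  using assms mul_one_left[of g n "m + 1"] mul_one_right[of f m "n + 1"]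
  by (simp add: bracket_kernel_iff bracket_leibniz mul_closed signed_def algebra_simps)

lemma unit_bracket_kernel: "e \<in> bracket_kernel 0"
  using D_closed unit_left[OF D_closed] unit_right[OF D_closed]
  by (simp add: bracket_kernel_iff unit_closed bracket_def signed_def)

text \<open>
  If \<open>b\<close> is the commutator of \<open>h\<close> and \<open>y\<close> has commutator zero, the second term of the Leibniz
  rule for \<open>h y\<close> vanishes and \<open>b y\<close> is the commutator of \<open>h y\<close>.
\<close>

lemma bracket_image_mul_left:
  assumes b: "b \<in> bracket_image i" and y: "y \<in> bracket_kernel j"
  shows "mul i j b y \<in> bracket_image (i + j)"
proof -
  obtain h where h: "h \<in> carrier (G (i - 1))" "b = bracket (i - 1) h"
    using b by (auto simp: bracket_image_def)
  have "b \<in> carrier (G i)"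
    using bracket_closed[OF h(1)] h(2) by simp
  then have "bracket (i - 1 + j) (mul (i - 1) j h y) = mul i j b y"
    using bracket_leibniz[OF h(1), of y j] y h mul_one_right[OF h(1), of "j + 1"] mul_closed[of b i y j]
    by (simp add: bracket_kernel_iff signed_def algebra_simps)
  moreover have "mul (i - 1) j h y \<in> carrier (G (i + j - 1))"
    using mul_closed[OF h(1), of y j] y by (simp add: bracket_kernel_iff algebra_simps)
  ultimately show ?thesis
    unfolding bracket_image_def by (metis add_diff_eq add.commute diff_add_eq image_eqI)
qed

text \<open>
  On this side the commutator of \<open>x h\<close> is \<open>x b\<close> only up to the sign \<open>(-1)\<^sup>i\<close>, which is harmless
  because the image is closed under negation.
\<close>

lemma bracket_image_mul_right:
  assumes x: "x \<in> bracket_kernel i" and b: "b \<in> bracket_image j"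
  shows "mul i j x b \<in> bracket_image (i + j)"
proof -
  obtain h where h: "h \<in> carrier (G (j - 1))" "b = bracket (j - 1) h"
    using b by (auto simp: bracket_image_def)
  have xb: "mul i j x b \<in> carrier (G (i + j))"
    using bracket_closed[OF h(1)] h(2) x by (simp add: bracket_kernel_iff mul_closed)
  have "bracket (i + j - 1) (mul i (j - 1) x h) = signed i (i + j) (mul i j x b)"
    using bracket_leibniz[OF _ h(1), of x i] x h mul_one_left[OF h(1), of "i + 1"] xb
    by (simp add: bracket_kernel_iff signed_closed algebra_simps)
  moreover have "mul i (j - 1) x h \<in> carrier (G (i + j - 1))"
    using mul_closed[OF _ h(1), of x i] x by (simp add: bracket_kernel_iff algebra_simps)
  ultimately have "signed i (i + j) (mul i j x b) \<in> bracket_image (i + j)"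
    unfolding bracket_image_def by (metis image_eqI)
  then show ?thesis
    using xb subgroup.m_inv_closed[OF subgroup_bracket_image, of _ "i + j"]
    by (fastforce simp: signed_def split: if_splits)
qed

theorem graded_subquotient_bracket:
  "graded_subquotient G mul e bracket_kernel bracket_image"
proof (intro graded_subquotient.intro graded_subproduct.intro graded_subproduct_axioms.intro
    graded_subquotient_axioms.intro)
  show "subgroup (bracket_image n) ((G n)\<lparr>carrier := bracket_kernel n\<rparr>)" for n
    using G.subgroup_incl[OF subgroup_bracket_image subgroup_bracket_kernel bracket_image_subset_kernel] .
qed (simp_all add: graded_product_axioms subgroup_bracket_kernel bracket_kernel_mul
    unit_bracket_kernel bracket_image_mul_left bracket_image_mul_right)

end

section \<open>The endomorphism algebra of a complex\<close>

lemma lin_mapsI: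
  assumes "\<And>x. x \<in> carrier M \<Longrightarrow> f x \<in> carrier N"
    and "\<And>x y. \<lbrakk>x \<in> carrier M; y \<in> carrier M\<rbrakk> \<Longrightarrow> f (x \<oplus>\<^bsub>M\<^esub> y) = f x \<oplus>\<^bsub>N\<^esub> f y"
    and "\<And>a x. \<lbrakk>a \<in> carrier A; x \<in> carrier M\<rbrakk> \<Longrightarrow> f (a \<odot>\<^bsub>M\<^esub> x) = a \<odot>\<^bsub>N\<^esub> f x"
    and "f \<in> extensional (carrier M)"
  shows "f \<in> lin_maps A M N"
  using assms by (auto simp: lin_maps_def PiE_def)

lemma lin_mapsD:
  assumes "f \<in> lin_maps A M N"
  shows "x \<in> carrier M \<Longrightarrow> f x \<in> carrier N"
    and "\<lbrakk>x \<in> carrier M; y \<in> carrier M\<rbrakk> \<Longrightarrow> f (x \<oplus>\<^bsub>M\<^esub> y) = f x \<oplus>\<^bsub>N\<^esub> f y"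
    and "\<lbrakk>a \<in> carrier A; x \<in> carrier M\<rbrakk> \<Longrightarrow> f (a \<odot>\<^bsub>M\<^esub> x) = a \<odot>\<^bsub>N\<^esub> f x"
    and "f \<in> extensional (carrier M)"
  using assms by (auto simp: lin_maps_def PiE_def)

text \<open>
  Linear maps take the value \<^const>\<open>undefined\<close> outside their source, so only arguments in the
  source need to be compared.
\<close>

lemma lin_maps_ext:
  assumes "f \<in> lin_maps A M N" "g \<in> lin_maps A M N" "\<And>x. x \<in> carrier M \<Longrightarrow> f x = g x"
  shows "f = g"
  using assms by (intro extensionalityI[of f "carrier M" g]) (auto dest: lin_mapsD(4))

lemma lin_maps_compose:
  assumes M: "left_module A M" and g: "g \<in> lin_maps A M N" and f: "f \<in> lin_maps A N P"
  shows "compose (carrier M) f g \<in> lin_maps A M P"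
proof -
  interpret left_module A M
    by (rule M)
  show ?thesis
    by (rule lin_mapsI) (simp_all add: compose_eq lin_mapsD[OF f] lin_mapsD[OF g] smult_closed)
qed

lemma (in left_module) smult_zero:
  assumes "a \<in> carrier R"
  shows "a \<odot>\<^bsub>M\<^esub> \<zero>\<^bsub>M\<^esub> = \<zero>\<^bsub>M\<^esub>"
proof -
  have "a \<odot>\<^bsub>M\<^esub> \<zero>\<^bsub>M\<^esub> \<oplus>\<^bsub>M\<^esub> a \<odot>\<^bsub>M\<^esub> \<zero>\<^bsub>M\<^esub> = a \<odot>\<^bsub>M\<^esub> \<zero>\<^bsub>M\<^esub>"
    using smult_r_distr[of a "\<zero>\<^bsub>M\<^esub>" "\<zero>\<^bsub>M\<^esub>"] assms by simp
  then show ?thesis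
    using smult_closed[of a "\<zero>\<^bsub>M\<^esub>"] assms by simp
qed

lemma (in left_module) smult_minus:
  assumes "a \<in> carrier R" "x \<in> carrier M"
  shows "a \<odot>\<^bsub>M\<^esub> (\<ominus>\<^bsub>M\<^esub> x) = \<ominus>\<^bsub>M\<^esub> (a \<odot>\<^bsub>M\<^esub> x)"
proof -
  have "a \<odot>\<^bsub>M\<^esub> (\<ominus>\<^bsub>M\<^esub> x) \<oplus>\<^bsub>M\<^esub> a \<odot>\<^bsub>M\<^esub> x = \<zero>\<^bsub>M\<^esub>"
    using smult_r_distr[of a "\<ominus>\<^bsub>M\<^esub> x" x] assms by (simp add: M.l_neg smult_zero)
  then show ?thesis
    using assms by (simp add: M.minus_equality smult_closed)
qed

lemma
  assumes M: "left_module A M" and N: "left_module A N"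
  shows comm_group_Hom: "comm_group (Hom_group A M N)"
    and inv_Hom: "f \<in> lin_maps A M N \<Longrightarrow> inv\<^bsub>Hom_group A M N\<^esub> f = (\<lambda>x\<in>carrier M. \<ominus>\<^bsub>N\<^esub> f x)"
proof -
  interpret M: left_module A M
    by (rule M)
  interpret N: left_module A N
    by (rule N)
  have add: "(\<lambda>x\<in>carrier M. f x \<oplus>\<^bsub>N\<^esub> g x) \<in> lin_maps A M N"
    if "f \<in> lin_maps A M N" "g \<in> lin_maps A M N" for f g
    by (rule lin_mapsI)
      (simp_all add: lin_mapsD[OF that(1)] lin_mapsD[OF that(2)] N.M.a_ac M.smult_closed N.smult_r_distr)
  have zero: "(\<lambda>x\<in>carrier M. \<zero>\<^bsub>N\<^esub>) \<in> lin_maps A M N"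
    by (rule lin_mapsI) (simp_all add: M.smult_closed N.smult_zero)
  have neg: "(\<lambda>x\<in>carrier M. \<ominus>\<^bsub>N\<^esub> f x) \<in> lin_maps A M N" if "f \<in> lin_maps A M N" for f
    by (rule lin_mapsI)
      (simp_all add: lin_mapsD[OF that] N.M.minus_add M.smult_closed N.smult_minus)
  have l_neg: "(\<lambda>x\<in>carrier M. (\<lambda>x\<in>carrier M. \<ominus>\<^bsub>N\<^esub> f x) x \<oplus>\<^bsub>N\<^esub> f x) = (\<lambda>x\<in>carrier M. \<zero>\<^bsub>N\<^esub>)"
    if "f \<in> lin_maps A M N" for f
    using lin_mapsD(1)[OF that] by (auto simp: N.M.l_neg)
  show comm: "comm_group (Hom_group A M N)"
  proof (rule comm_groupI, unfold Hom_group_def monoid.simps partial_object.simps)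
    fix f g h
    assume f: "f \<in> lin_maps A M N"
    show "(\<lambda>x\<in>carrier M. (\<lambda>x\<in>carrier M. \<zero>\<^bsub>N\<^esub>) x \<oplus>\<^bsub>N\<^esub> f x) = f"
      by (rule lin_maps_ext[OF add[OF zero f] f]) (simp add: lin_mapsD[OF f])
    show "\<exists>g\<in>lin_maps A M N. (\<lambda>x\<in>carrier M. g x \<oplus>\<^bsub>N\<^esub> f x) = (\<lambda>x\<in>carrier M. \<zero>\<^bsub>N\<^esub>)"
      using neg[OF f] l_neg[OF f] by blast
    assume g: "g \<in> lin_maps A M N"
    show "(\<lambda>x\<in>carrier M. f x \<oplus>\<^bsub>N\<^esub> g x) \<in> lin_maps A M N"
      using f g by (rule add)
    show "(\<lambda>x\<in>carrier M. f x \<oplus>\<^bsub>N\<^esub> g x) = (\<lambda>x\<in>carrier M. g x \<oplus>\<^bsub>N\<^esub> f x)"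
      using lin_mapsD(1)[OF f] lin_mapsD(1)[OF g] by (auto simp: N.M.a_comm)
    assume h: "h \<in> lin_maps A M N"
    show "(\<lambda>x\<in>carrier M. (\<lambda>x\<in>carrier M. f x \<oplus>\<^bsub>N\<^esub> g x) x \<oplus>\<^bsub>N\<^esub> h x)
        = (\<lambda>x\<in>carrier M. f x \<oplus>\<^bsub>N\<^esub> (\<lambda>x\<in>carrier M. g x \<oplus>\<^bsub>N\<^esub> h x) x)"
      by (rule restrict_ext) (simp add: lin_mapsD[OF f] lin_mapsD[OF g] lin_mapsD[OF h] N.M.a_assoc)
  qed (rule zero)
  show "inv\<^bsub>Hom_group A M N\<^esub> f = (\<lambda>x\<in>carrier M. \<ominus>\<^bsub>N\<^esub> f x)" if "f \<in> lin_maps A M N"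
    using l_neg[OF that] neg[OF that] that
    by (intro group.inv_equality[OF comm_group.axioms(2)[OF comm]]) (simp_all add: Hom_group_def)
qed


context chain_complex
begin

interpretation M: left_module A "C p" for p
  by (rule left_module)

lemma carrier_End: "f \<in> carrier (End_deg A C n) \<longleftrightarrow> (\<forall>p. f p \<in> lin_maps A (C p) (C (p - n)))"
  by (auto simp: End_deg_def Hom_group_def)

lemma mult_End: "f \<otimes>\<^bsub>End_deg A C n\<^esub> g = (\<lambda>p. \<lambda>x\<in>carrier (C p). f p x \<oplus>\<^bsub>C (p - n)\<^esub> g p x)"
  by (simp add: End_deg_def Hom_group_def restrict_UNIV)

lemma one_End: "\<one>\<^bsub>End_deg A C n\<^esub> = (\<lambda>p. \<lambda>x\<in>carrier (C p). \<zero>\<^bsub>C (p - n)\<^esub>)"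
  by (simp add: End_deg_def Hom_group_def restrict_UNIV)

lemma comm_group_End: "comm_group (End_deg A C n)"
proof (rule group.group_comm_groupI)
  have Hom: "comm_group (Hom_group A (C p) (C (p - n)))" for p
    by (intro comm_group_Hom left_module)
  then show "group (End_deg A C n)"
    unfolding End_deg_def by (intro product_group comm_group.axioms(2))
  show "f \<otimes>\<^bsub>End_deg A C n\<^esub> g = g \<otimes>\<^bsub>End_deg A C n\<^esub> f"
    if "f \<in> carrier (End_deg A C n)" "g \<in> carrier (End_deg A C n)" for f g
    using that comm_groupE(4)[OF Hom] by (auto simp: End_deg_def PiE_iff fun_eq_iff)
qed

lemma inv_End:
  assumes "f \<in> carrier (End_deg A C n)"
  shows "inv\<^bsub>End_deg A C n\<^esub> f = (\<lambda>p. \<lambda>x\<in>carrier (C p). \<ominus>\<^bsub>C (p - n)\<^esub> f p x)"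
proof -
  have "group (Hom_group A (C p) (C (p - n)))" for p
    by (intro comm_group.axioms(2) comm_group_Hom left_module)
  then have "inv\<^bsub>End_deg A C n\<^esub> f = (\<lambda>p. inv\<^bsub>Hom_group A (C p) (C (p - n))\<^esub> f p)"
    using assms by (simp add: End_deg_def restrict_UNIV)
  then show ?thesis
    using assms by (simp add: carrier_End inv_Hom left_module)
qed

lemma End_ext:
  assumes "f \<in> carrier (End_deg A C n)" "g \<in> carrier (End_deg A C n)"
    and "\<And>p x. x \<in> carrier (C p) \<Longrightarrow> f p x = g p x"
  shows "f = g"
  using assms by (intro ext[of f g] lin_maps_ext) (auto simp: carrier_End)

lemma End_apply_closed:
  "\<lbrakk>f \<in> carrier (End_deg A C n); x \<in> carrier (C p)\<rbrakk> \<Longrightarrow> f p x \<in> carrier (C (p - n))"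
  by (meson carrier_End lin_mapsD(1))

lemma end_comp_closed:
  assumes f: "f \<in> carrier (End_deg A C m)" and g: "g \<in> carrier (End_deg A C n)"
  shows "end_comp C n f g \<in> carrier (End_deg A C (m + n))"
proof -
  have "compose (carrier (C p)) (f (p - n)) (g p) \<in> lin_maps A (C p) (C (p - n - m))" for p
    using f g by (intro lin_maps_compose[of _ _ _ "C (p - n)"] left_module) (auto simp: carrier_End)
  then show ?thesis
    by (simp add: carrier_End end_comp_def algebra_simps)
qed

text \<open>
  Distributivity in the left factor is the pointwise definition of sums of maps; distributivity in
  the right factor is the additivity of the left one.
\<close>

lemma graded_product_End: "graded_product (End_deg A C) (\<lambda>m n. end_comp C n) (end_id C)"
proof (rule graded_product.intro)
  have degs: "p - j - i = p - (i + j)" for p i j :: int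
    by simp
  show "comm_group (End_deg A C n)" for n
    by (rule comm_group_End)
  show id: "end_id C \<in> carrier (End_deg A C 0)"
    by (auto simp: carrier_End end_id_def M.smult_closed intro!: lin_mapsI)
  fix i j k f g h
  assume f: "f \<in> carrier (End_deg A C i)"
  show "end_comp C i (end_id C) f = f"
    using End_ext[OF end_comp_closed[OF id f, simplified] f] f
    by (simp add: end_comp_def end_id_def compose_eq End_apply_closed)
  show "end_comp C 0 f (end_id C) = f"
    using End_ext[OF end_comp_closed[OF f id, simplified] f]
    by (simp add: end_comp_def end_id_def compose_eq)
  assume g: "g \<in> carrier (End_deg A C j)"
  show "end_comp C j f g \<in> carrier (End_deg A C (i + j))"
    using f g by (rule end_comp_closed)
  assume h: "h \<in> carrier (End_deg A C k)"
  show "end_comp C k (end_comp C j f g) h = end_comp C (j + k) f (end_comp C k g h)"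
    using h by (auto simp: end_comp_def compose_def End_apply_closed degs fun_eq_iff)
next
  fix i j f f' g
  assume "f \<in> carrier (End_deg A C i)" "f' \<in> carrier (End_deg A C i)" "g \<in> carrier (End_deg A C j)"
  then show "end_comp C j (f \<otimes>\<^bsub>End_deg A C i\<^esub> f') g =
      end_comp C j f g \<otimes>\<^bsub>End_deg A C (i + j)\<^esub> end_comp C j f' g"
    by (auto simp: end_comp_def compose_def mult_End End_apply_closed fun_eq_iff diff_diff_eq add.commute)
next
  fix i j f g g'
  assume f: "f \<in> carrier (End_deg A C i)"
    and "g \<in> carrier (End_deg A C j)" "g' \<in> carrier (End_deg A C j)"
  then show "end_comp C j f (g \<otimes>\<^bsub>End_deg A C j\<^esub> g') =
      end_comp C j f g \<otimes>\<^bsub>End_deg A C (i + j)\<^esub> end_comp C j f g'"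
    using f[unfolded carrier_End, rule_format, THEN lin_mapsD(2)]
    by (auto simp: end_comp_def compose_def mult_End End_apply_closed fun_eq_iff diff_diff_eq add.commute)
qed

lemma inner_differential_End:
  "inner_differential (End_deg A C) (\<lambda>m n. end_comp C n) (end_id C) d"
proof (intro inner_differential.intro inner_differential_axioms.intro graded_product_End)
  show "d \<in> carrier (End_deg A C 1)"
    by (simp add: carrier_End d_linear)
  show "end_comp C 1 d d = \<one>\<^bsub>End_deg A C 2\<^esub>"
    by (auto simp: end_comp_def compose_def one_End d_squared fun_eq_iff)
qed

sublocale inner_differential "End_deg A C" "\<lambda>m n. end_comp C n" "end_id C" d
  by (rule inner_differential_End)

text \<open>
  This identity is the reason why the computations with the differential of the endomorphism
  algebra need no elements of modules: they are computations with words in \<open>d\<close> and \<open>f\<close>.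
\<close>

lemma end_diff_eq_bracket:
  assumes f: "f \<in> carrier (End_deg A C n)"
  shows "end_diff C d n f = bracket n f"
proof -
  have fd: "end_comp C 1 f d \<in> carrier (End_deg A C (n + 1))"
    by (rule D_mul_closed(2)[OF f])
  have inv: "inv\<^bsub>End_deg A C (n + 1)\<^esub> end_comp C 1 f d \<in> carrier (End_deg A C (n + 1))"
    using fd comm_group.axioms(2)[OF comm_group_End] by (simp add: group.inv_closed)
  have comp: "end_comp C n d f p x = d (p - n) (f p x)" "end_comp C 1 f d p x = f (p - 1) (d p x)"
    if "x \<in> carrier (C p)" for p x
    using that by (simp_all add: end_comp_def compose_eq)
  have neg: "(inv\<^bsub>End_deg A C (n + 1)\<^esub> end_comp C 1 f d) p x = \<ominus>\<^bsub>C (p - (n + 1))\<^esub> f (p - 1) (d p x)"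
    if "x \<in> carrier (C p)" for p x
    using that by (simp add: inv_End[OF fd] comp)
  have neg_neg: "(inv\<^bsub>End_deg A C (n + 1)\<^esub> (inv\<^bsub>End_deg A C (n + 1)\<^esub> end_comp C 1 f d)) p x
      = \<ominus>\<^bsub>C (p - (n + 1))\<^esub> (\<ominus>\<^bsub>C (p - (n + 1))\<^esub> f (p - 1) (d p x))"
    if "x \<in> carrier (C p)" for p x
    by (subst inv_End[OF inv]) (simp add: that neg)
  show ?thesis
    by (auto simp: fun_eq_iff bracket_def signed_def end_diff_def mult_End comp neg neg_neg
        a_minus_def diff_diff_eq)
qed

lemma cocycles_eq_bracket_kernel: "cocycles A C d = bracket_kernel"
  by (auto simp: fun_eq_iff cocycles_def kernel_def bracket_kernel_iff end_diff_eq_bracket)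

lemma coboundaries_eq_bracket_image: "coboundaries A C d = bracket_image"
  by (auto simp: fun_eq_iff coboundaries_def bracket_image_def end_diff_eq_bracket)

sublocale graded_subquotient "End_deg A C" "\<lambda>m n. end_comp C n" "end_id C" "cocycles A C d" "coboundaries A C d"
  unfolding cocycles_eq_bracket_kernel coboundaries_eq_bracket_image
  by (rule graded_subquotient_bracket)

lemma cohomology_eq_quotient:
  shows "cohomology A C d = quotient"
    and "coh_class A C d = residue"
    and "coh_mult A C d = residue_mul"
  by (simp_all add: fun_eq_iff cohomology_def quotient_def coh_class_def residue_def coh_mult_def
      residue_mul_def)

text \<open>
  The differential raises degrees by one, so its value in degree \<open>n\<close> depends on the component of
  degree \<open>n - 1\<close>; after this shift, a vanishing differential means that each component is a
  cocycle.
\<close>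

lemma kernel_End_differential:
  "a_kernel (End_algebra A C) (End_algebra A C) (End_differential C d) = sub_total"
proof (rule Set.set_eqI)
  fix y
  have "End_differential C d y = \<zero>\<^bsub>total\<^esub>
      \<longleftrightarrow> (\<forall>n. end_diff C d (n - 1) (y (n - 1)) = \<one>\<^bsub>End_deg A C n\<^esub>)"
    unfolding End_differential_def zero_total by (rule fun_eq_iff)
  also have "\<dots> \<longleftrightarrow> (\<forall>n. end_diff C d n (y n) = \<one>\<^bsub>End_deg A C (n + 1)\<^esub>)"
    by (metis add_diff_cancel_right' diff_add_cancel)
  finally show "y \<in> a_kernel (End_algebra A C) (End_algebra A C) (End_differential C d)
      \<longleftrightarrow> y \<in> sub_total"
    by (auto simp: a_kernel_def' End_algebra_def sub_total_def cocycles_def kernel_def carrier_total)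
qed

end

theorem theorem2:
  fixes A :: "('a, 'k) ring_scheme"
    and C :: "int \<Rightarrow> ('a, 'b, 'm) module_scheme"
    and d :: "int \<Rightarrow> 'b \<Rightarrow> 'b"
  defines "Y \<equiv> End_algebra A C"
    and "Z \<equiv> cocycles A C d"
    and "cl \<equiv> coh_class A C d"
    and "H \<equiv> cohomology A C d"
    and "HY \<equiv> cohomology_algebra A C d"
    and "ZY \<equiv> a_kernel (End_algebra A C) (End_algebra A C) (End_differential C d)"
  assumes "chain_complex A C d"
  shows "(\<forall>m n. \<forall>f\<in>Z m. \<forall>g\<in>Z n. end_comp C n f g \<in> Z (m + n) \<and>
            (\<forall>f'\<in>Z m. \<forall>g'\<in>Z n. cl m f = cl m f' \<longrightarrow> cl n g = cl n g' \<longrightarrow>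
              cl (m + n) (end_comp C n f g) = cl (m + n) (end_comp C n f' g')))
       \<and> graded_ring HY (\<lambda>n. homogeneous H n ` carrier (H n))
       \<and> (\<forall>m n. \<forall>f\<in>Z m. \<forall>g\<in>Z n.
            homogeneous H m (cl m f) \<otimes>\<^bsub>HY\<^esub> homogeneous H n (cl n g)
              = homogeneous H (m + n) (cl (m + n) (end_comp C n f g)))
       \<and> subring ZY Y
       \<and> (\<lambda>y n. cl n (y n)) \<in> ring_hom (Y\<lparr>carrier := ZY\<rparr>) HY"
proof -
  interpret chain_complex A C d
    by fact
  interpret H: graded_product H residue_mul "residue 0 (end_id C)"
    unfolding H_def cohomology_eq_quotient by (rule graded_product_quotient)
  have HY: "HY = graded_sum H residue_mul (residue 0 (end_id C))"
    by (simp add: HY_def H_def cohomology_algebra_def cohomology_eq_quotient)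
  have cl: "cl = residue"
    by (simp add: cl_def cohomology_eq_quotient)
  have ZY: "ZY = sub_total"
    by (simp add: ZY_def kernel_End_differential)
  have "end_comp C n f g \<in> Z (m + n)" if "f \<in> Z m" "g \<in> Z n" for m n f g
    using that unfolding Z_def by (rule sub_mul_closed)
  moreover have "cl (m + n) (end_comp C n f g) = cl (m + n) (end_comp C n f' g')"
    if "f \<in> Z m" "g \<in> Z n" "f' \<in> Z m" "g' \<in> Z n" "cl m f = cl m f'" "cl n g = cl n g'"
    for m n f g f' g'
    using that residue_mul_residue[of f m g n] residue_mul_residue[of f' m g' n]
    by (simp add: Z_def cl)
  moreover have "homogeneous H m (cl m f) \<otimes>\<^bsub>HY\<^esub> homogeneous H n (cl n g)
      = homogeneous H (m + n) (cl (m + n) (end_comp C n f g))"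
    if "f \<in> Z m" "g \<in> Z n" for m n f g
    using that H.mult_homogeneous[of "cl m f" m "cl n g" n]
    by (simp add: HY cl Z_def residue_mul_residue H_def cohomology_eq_quotient carrier_quotient)
  moreover have "graded_ring HY (\<lambda>n. homogeneous H n ` carrier (H n))"
    unfolding HY by (rule H.graded_ring_total)
  moreover have "subring ZY Y"
    using subring_sub_total by (simp add: ZY Y_def End_algebra_def)
  moreover have "(\<lambda>y n. cl n (y n)) \<in> ring_hom (Y\<lparr>carrier := ZY\<rparr>) HY"
    using residue_ring_hom by (simp add: ZY Y_def End_algebra_def HY cl H_def cohomology_eq_quotient)
  ultimately show ?thesis
    by blast
qed

end
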